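(* Let $\tilde{\mathcal I}\subset \mathcal O((\mathbb C^n-\Delta)\times(\mathbb C^\times)^n)$ be the ideal generated by all functions $F_I(p)$ with $I\subset J$, $|I|=k-1$, and all functions $F_I(z,p)$ with $I\subset J$, $|I|=k+1$. Let $\hat{\mathcal I}\subset \mathcal O((\mathbb C^n-\Delta)\times(\mathbb C^\times)^n)$ be the ideal of functions that equal zero on $\Lambda$. Then $\tilde{\mathcal I}=\hat{\mathcal I}$, and $\Lambda\subset(\mathbb C^n-\Delta)\times(\mathbb C^\times)^n$ is a smooth Lagrangian subvariety.
   Context: Let $n>k$ be positive integers, $J=\{1,\dots,n\}$. Let $t_1,\dots,t_k$ be coordinates on $\mathbb C^k$ and $z_1,\dots,z_n$ coordinates on $\mathbb C^n$. Fix linear functions $g_j=\sum_{m=1}^k b_j^m t_m$, $j\in J$, with $b_j^m\in\mathbb C$, and put $d_{i_1,\dots,i_k}=\det_{\ell,m=1}^k(b^m_{i_\ell})$. Assume $d_{i_1,\dots,i_k}\neq0$ whenever $i_1,\dots,i_k\in J$ are distinct. Put $f_j(z,t)=z_j+g_j(t)$ on $\mathbb C^n\times\mathbb C^k$. For distinct $i_1,\dots,i_{k+1}\in J$ put $$f_{i_1,\dots,i_{k+1}}(z)=\sum_{m=1}^{k+1}(-1)^{m-1}d_{i_1,\dots,\widehat{i_m},\dots,i_{k+1}}z_{i_m},$$ and let $\Delta\subset\mathbb C^n$ be the union over all $(k+1)$-element subsets $\{i_1<\dots<i_{k+1}\}\subset J$ of the hyperplanes $f_{i_1,\dots,i_{k+1}}(z)=0$.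 Fix nonzero weights $a_j\in\mathbb C^\times$, $j\in J$, with $|a|=\sum_{j\in J}a_j\neq0$. The master function is $\Phi(z,t)=\sum_{j\in J}a_j\log f_j(z,t)$. Let $U^0=\{(z,t)\in\mathbb C^n\times\mathbb C^k : z\notin\Delta,\ f_j(z,t)\ne0\ \text{for all } j\in J\}$ and $C_\Phi=\{(z,t)\in U^0: \partial\Phi/\partial t_i(z,t)=0,\ i=1,\dots,k\}$. Consider the map $\phi:C_\Phi\to(\mathbb C^n-\Delta)\times(\mathbb C^\times)^n$, $(z,t)\mapsto(z_1,\dots,z_n,p_1,\dots,p_n)$ with $p_j=\frac{\partial\Phi}{\partial z_j}(z,t)=a_j/f_j(z,t)$, and put $\Lambda=\phi(C_\Phi)$. Here $(\mathbb C^n-\Delta)\times(\mathbb C^\times)^n$ is regarded as the open subset of the cotangent bundle $T^*(\mathbb C^n-\Delta)$, with symplectic form $\omega=\sum_{j=1}^n dp_j\wedge dz_j$, where all $p_j$ are nonzero. For a subset $I=\{i_1,\dots,i_{k-1}\}$ of $k-1$ distinct elements of $J$, $F_I(p)=\sum_{j\in J}d_{j,i_1,\dots,i_{k-1}}p_j$. For a subset $I=\{i_1,\dots,i_{k+1}\}$ of $k+1$ distinct elements of $J$, $$F_I(z,p)=p_{i_1}\cdots p_{i_{k+1}}f_{i_1,\dots,i_{k+1}}(z)+\sum_{m=1}^{k+1}(-1)^m a_{i_m}d_{i_1,\dots,\widehat{i_m},\dots,i_{k+1}}\,p_{i_1}\cdots\widehat{p_{i_m}}\cdots p_{i_{k+1}}.$$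 (The elements of $I$ are listed in any fixed order; changing the order changes $F_I$ at most by a sign.) $\mathcal O(X)$ denotes the algebra of regular functions on $X$. *)

theory Defs
  imports
    "HOL-Analysis.Complex_Analysis_Basics"
    "HOL-Algebra.Ideal"
    "Jordan_Normal_Form.Determinant"
begin

section \<open>Algebraic geometry in \<open>T\<^sup>*\<complex>\<^sup>n = \<complex>\<^sup>n \<times> \<complex>\<^sup>n\<close>\<close>

text \<open>Points and tangent vectors are pairs \<open>(z, p)\<close> of vectors of dimension \<open>n\<close>.\<close>

type_synonym phase_point = "complex vec \<times> complex vec"

definition phase_space :: "nat \<Rightarrow> phase_point set" where
  "phase_space n = carrier_vec n \<times> carrier_vec n"

text \<open>Since \<open>\<complex>\<close> is infinite, polynomials in \<open>z\<^sub>j, p\<^sub>j\<close> are the same thing as polynomial functions.\<close>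

inductive_set poly_fun :: "nat \<Rightarrow> (phase_point \<Rightarrow> complex) set" for n :: nat where
  const: "(\<lambda>_. c) \<in> poly_fun n"
| coord_z: "j < n \<Longrightarrow> (\<lambda>(z, p). z $ j) \<in> poly_fun n"
| coord_p: "j < n \<Longrightarrow> (\<lambda>(z, p). p $ j) \<in> poly_fun n"
| add: "F \<in> poly_fun n \<Longrightarrow> G \<in> poly_fun n \<Longrightarrow> (\<lambda>x. F x + G x) \<in> poly_fun n"
| mult: "F \<in> poly_fun n \<Longrightarrow> G \<in> poly_fun n \<Longrightarrow> (\<lambda>x. F x * G x) \<in> poly_fun n"

text \<open>The Zariski topology on a subset \<open>X\<close> of \<open>phase_space n\<close>.\<close>

definition zariski_closed_in :: "nat \<Rightarrow> phase_point set \<Rightarrow> phase_point set \<Rightarrow> bool" where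
  "zariski_closed_in n X Y \<longleftrightarrow>
     (\<exists>S \<subseteq> poly_fun n. Y = {x \<in> X. \<forall>F\<in>S. F x = 0})"

definition zariski_open_in :: "nat \<Rightarrow> phase_point set \<Rightarrow> phase_point set \<Rightarrow> bool" where
  "zariski_open_in n X U \<longleftrightarrow> U \<subseteq> X \<and> zariski_closed_in n X (X - U)"

definition regular_on :: "nat \<Rightarrow> phase_point set \<Rightarrow> (phase_point \<Rightarrow> complex) \<Rightarrow> bool" where
  "regular_on n X \<phi> \<longleftrightarrow>
     (\<forall>x\<in>X. \<exists>U G H. zariski_open_in n X U \<and> x \<in> U \<and> G \<in> poly_fun n \<and> H \<in> poly_fun n \<and>
        (\<forall>y\<in>U. H y \<noteq> 0 \<and> \<phi> y = G y / H y))"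

text \<open>The algebra \<open>\<O>(X)\<close>. Its elements are made extensional, i.e. \<open>undefined\<close> outside \<open>X\<close>,
  so that two of them are equal iff they agree on \<open>X\<close>.\<close>

definition regular_ring :: "nat \<Rightarrow> phase_point set \<Rightarrow> (phase_point \<Rightarrow> complex) ring" where
  "regular_ring n X =
     \<lparr>carrier = {\<phi> \<in> extensional X. regular_on n X \<phi>},
      mult = (\<lambda>\<phi> \<psi>. \<lambda>x\<in>X. \<phi> x * \<psi> x), one = (\<lambda>x\<in>X. 1),
      zero = (\<lambda>x\<in>X. 0), add = (\<lambda>\<phi> \<psi>. \<lambda>x\<in>X. \<phi> x + \<psi> x)\<rparr>"

definition vanishing_ideal ::
    "nat \<Rightarrow> phase_point set \<Rightarrow> phase_point set \<Rightarrow> (phase_point \<Rightarrow> complex) set" where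
  "vanishing_ideal n X Y = {\<phi> \<in> carrier (regular_ring n X). \<forall>x\<in>Y. \<phi> x = 0}"

text \<open>A subvariety of \<open>X\<close> is an irreducible (in particular nonempty) Zariski closed subset.\<close>

definition zariski_irreducible_in :: "nat \<Rightarrow> phase_point set \<Rightarrow> phase_point set \<Rightarrow> bool" where
  "zariski_irreducible_in n X Y \<longleftrightarrow> Y \<noteq> {} \<and>
     (\<forall>A B. zariski_closed_in n X A \<longrightarrow> zariski_closed_in n X B \<longrightarrow> Y \<subseteq> A \<union> B \<longrightarrow> Y \<subseteq> A \<or> Y \<subseteq> B)"

definition subvariety :: "nat \<Rightarrow> phase_point set \<Rightarrow> phase_point set \<Rightarrow> bool" where
  "subvariety n X Y \<longleftrightarrow> zariski_closed_in n X Y \<and> zariski_irreducible_in n X Y"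

text \<open>The value \<open>d\<phi>\<^sub>x(v)\<close> of the differential, for \<open>\<phi>\<close> regular near the point \<open>x\<close>.\<close>

definition differential ::
    "(phase_point \<Rightarrow> complex) \<Rightarrow> phase_point \<Rightarrow> phase_point \<Rightarrow> complex" where
  "differential \<phi> x v =
     deriv (\<lambda>s. \<phi> (fst x + s \<cdot>\<^sub>v fst v, snd x + s \<cdot>\<^sub>v snd v)) 0"

text \<open>For \<open>X\<close> open in \<open>phase_space n\<close>, a closed subset \<open>Y\<close> of \<open>X\<close> is smooth of codimension \<open>r\<close>
  if near each of its points it is the zero set of \<open>r\<close> regular functions
  whose differentials at the point are linearly independent.\<close>

definition smooth_of_codim ::
    "nat \<Rightarrow> phase_point set \<Rightarrow> phase_point set \<Rightarrow> nat \<Rightarrow> bool" where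
  "smooth_of_codim n X Y r \<longleftrightarrow>
     (\<forall>x\<in>Y. \<exists>U F. zariski_open_in n X U \<and> x \<in> U \<and> (\<forall>i<r. regular_on n U (F i)) \<and>
        Y \<inter> U = {y \<in> U. \<forall>i<r. F i y = 0} \<and>
        (\<forall>c :: nat \<Rightarrow> complex.
           (\<forall>v \<in> phase_space n. (\<Sum>i<r. c i * differential (F i) x v) = 0) \<longrightarrow>
           (\<forall>i<r. c i = 0)))"

definition zariski_tangent_space ::
    "nat \<Rightarrow> phase_point set \<Rightarrow> phase_point set \<Rightarrow> phase_point \<Rightarrow> phase_point set" where
  "zariski_tangent_space n X Y x =
     {v \<in> phase_space n. \<forall>\<phi> \<in> vanishing_ideal n X Y. differential \<phi> x v = 0}"

text \<open>The form \<open>\<omega> = \<Sum>\<^sub>j dp\<^sub>j \<and> dz\<^sub>j\<close>.\<close>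

definition symplectic_form :: "nat \<Rightarrow> phase_point \<Rightarrow> phase_point \<Rightarrow> complex" where
  "symplectic_form n v w = (\<Sum>j<n. snd v $ j * fst w $ j - snd w $ j * fst v $ j)"

text \<open>A subspace is Lagrangian if it equals its own \<open>\<omega>\<close>-orthogonal complement.\<close>

definition lagrangian_subspace :: "nat \<Rightarrow> phase_point set \<Rightarrow> bool" where
  "lagrangian_subspace n T \<longleftrightarrow>
     T = {v \<in> phase_space n. \<forall>w\<in>T. symplectic_form n v w = 0}"

definition smooth_lagrangian_subvariety ::
    "nat \<Rightarrow> phase_point set \<Rightarrow> phase_point set \<Rightarrow> bool" where
  "smooth_lagrangian_subvariety n X Y \<longleftrightarrow>
     subvariety n X Y \<and> smooth_of_codim n X Y n \<and>
     (\<forall>x\<in>Y. lagrangian_subspace n (zariski_tangent_space n X Y x))"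

section \<open>The family of arrangements and its master function\<close>

text \<open>Indices start at 0: \<open>J = {..<n}\<close>, the coordinates on \<open>\<complex>\<^sup>k\<close> are \<open>t $ m\<close> with \<open>m < k\<close>, and
  \<open>b j m\<close> is the coefficient \<open>b\<^sub>j\<^sup>m\<close>. A tuple \<open>i\<^sub>1, \<dots>, i\<^sub>r\<close> is a list \<open>is\<close> of length \<open>r\<close>, so that
  \<open>is ! m\<close> is \<open>i\<^bsub>m+1\<^esub>\<close>; this shifts the exponents of \<open>-1\<close> by one.\<close>

definition minor :: "(nat \<Rightarrow> nat \<Rightarrow> complex) \<Rightarrow> nat list \<Rightarrow> complex" where
  "minor b is = det (mat (length is) (length is) (\<lambda>(l, m). b (is ! l) m))"

definition omit_nth :: "nat \<Rightarrow> nat list \<Rightarrow> nat list" where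
  "omit_nth m is = take m is @ drop (Suc m) is"

text \<open>The subsets of \<open>J\<close> with \<open>r\<close> elements, each listed in increasing order.\<close>

definition index_lists :: "nat \<Rightarrow> nat \<Rightarrow> nat list set" where
  "index_lists n r = {is. length is = r \<and> sorted_wrt (<) is \<and> set is \<subseteq> {..<n}}"

definition f_fun ::
    "nat \<Rightarrow> (nat \<Rightarrow> nat \<Rightarrow> complex) \<Rightarrow> nat \<Rightarrow> complex vec \<Rightarrow> complex vec \<Rightarrow> complex" where
  "f_fun k b j z t = z $ j + (\<Sum>m<k. b j m * t $ m)"

definition f_circuit :: "(nat \<Rightarrow> nat \<Rightarrow> complex) \<Rightarrow> nat list \<Rightarrow> complex vec \<Rightarrow> complex" where
  "f_circuit b is z = (\<Sum>m<length is. (-1) ^ m * minor b (omit_nth m is) * z $ (is ! m))"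

definition discriminant :: "nat \<Rightarrow> nat \<Rightarrow> (nat \<Rightarrow> nat \<Rightarrow> complex) \<Rightarrow> complex vec set" where
  "discriminant n k b = (\<Union>is \<in> index_lists n (k + 1). {z \<in> carrier_vec n. f_circuit b is z = 0})"

definition log_branch_at :: "(complex \<Rightarrow> complex) \<Rightarrow> complex \<Rightarrow> bool" where
  "log_branch_at L w \<longleftrightarrow>
     (\<exists>S. open S \<and> w \<in> S \<and> L holomorphic_on S \<and> (\<forall>u\<in>S. exp (L u) = u))"

text \<open>The branch of the master function \<open>\<Phi>\<close> in which the logarithm of \<open>f\<^sub>j\<close> is computed by \<open>L j\<close>.\<close>

definition master_branch ::
    "nat \<Rightarrow> nat \<Rightarrow> (nat \<Rightarrow> complex) \<Rightarrow> (nat \<Rightarrow> nat \<Rightarrow> complex) \<Rightarrow> (nat \<Rightarrow> complex \<Rightarrow> complex)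
      \<Rightarrow> complex vec \<Rightarrow> complex vec \<Rightarrow> complex" where
  "master_branch n k a b L z t = (\<Sum>j<n. a j * L j (f_fun k b j z t))"

definition U0 ::
    "nat \<Rightarrow> nat \<Rightarrow> (nat \<Rightarrow> nat \<Rightarrow> complex) \<Rightarrow> (complex vec \<times> complex vec) set" where
  "U0 n k b = {(z, t). z \<in> carrier_vec n \<and> t \<in> carrier_vec k \<and> z \<notin> discriminant n k b \<and>
                       (\<forall>j<n. f_fun k b j z t \<noteq> 0)}"

text \<open>Two branches of \<open>\<Phi>\<close> near a point of \<open>U0\<close> differ by a constant, so the partial
  derivatives \<open>\<partial>\<Phi>/\<partial>t\<^sub>i\<close> do not depend on the branch.\<close>

definition critical_set ::
    "nat \<Rightarrow> nat \<Rightarrow> (nat \<Rightarrow> complex) \<Rightarrow> (nat \<Rightarrow> nat \<Rightarrow> complex) \<Rightarrow> (complex vec \<times> complex vec) set" where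
  "critical_set n k a b =
     {(z, t) \<in> U0 n k b. \<exists>L. (\<forall>j<n. log_branch_at (L j) (f_fun k b j z t)) \<and>
        (\<forall>i<k. ((\<lambda>s. master_branch n k a b L z (t + s \<cdot>\<^sub>v unit_vec k i))
                   has_field_derivative 0) (at 0))}"

text \<open>Here \<open>a\<^sub>j / f\<^sub>j = \<partial>\<Phi>/\<partial>z\<^sub>j\<close>.\<close>

definition phi_map ::
    "nat \<Rightarrow> nat \<Rightarrow> (nat \<Rightarrow> complex) \<Rightarrow> (nat \<Rightarrow> nat \<Rightarrow> complex)
      \<Rightarrow> complex vec \<times> complex vec \<Rightarrow> phase_point" where
  "phi_map n k a b = (\<lambda>(z, t). (z, vec n (\<lambda>j. a j / f_fun k b j z t)))"

definition Lambda ::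
    "nat \<Rightarrow> nat \<Rightarrow> (nat \<Rightarrow> complex) \<Rightarrow> (nat \<Rightarrow> nat \<Rightarrow> complex) \<Rightarrow> phase_point set" where
  "Lambda n k a b = phi_map n k a b ` critical_set n k a b"

text \<open>The ambient space \<open>(\<complex>\<^sup>n - \<Delta>) \<times> (\<complex>\<^sup>\<times>)\<^sup>n\<close>.\<close>

definition ambient :: "nat \<Rightarrow> nat \<Rightarrow> (nat \<Rightarrow> nat \<Rightarrow> complex) \<Rightarrow> phase_point set" where
  "ambient n k b = (carrier_vec n - discriminant n k b) \<times> {p \<in> carrier_vec n. \<forall>j<n. p $ j \<noteq> 0}"

section \<open>The generators\<close>

definition F_linear ::
    "nat \<Rightarrow> (nat \<Rightarrow> nat \<Rightarrow> complex) \<Rightarrow> nat list \<Rightarrow> phase_point \<Rightarrow> complex" where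
  "F_linear n b is = (\<lambda>(z, p). \<Sum>j<n. minor b (j # is) * p $ j)"

definition F_circuit ::
    "(nat \<Rightarrow> complex) \<Rightarrow> (nat \<Rightarrow> nat \<Rightarrow> complex) \<Rightarrow> nat list \<Rightarrow> phase_point \<Rightarrow> complex" where
  "F_circuit a b is = (\<lambda>(z, p).
     (\<Prod>l<length is. p $ (is ! l)) * f_circuit b is z +
     (\<Sum>m<length is. (-1) ^ (m + 1) * a (is ! m) * minor b (omit_nth m is) *
        (\<Prod>l\<in>{..<length is} - {m}. p $ (is ! l))))"

definition generators ::
    "nat \<Rightarrow> nat \<Rightarrow> (nat \<Rightarrow> complex) \<Rightarrow> (nat \<Rightarrow> nat \<Rightarrow> complex) \<Rightarrow> (phase_point \<Rightarrow> complex) set" where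
  "generators n k a b =
     (\<lambda>is. restrict (F_linear n b is) (ambient n k b)) ` index_lists n (k - 1) \<union>
     (\<lambda>is. restrict (F_circuit a b is) (ambient n k b)) ` index_lists n (k + 1)"

end

theory Submission
  imports Defs "HOL-Library.Function_Algebras" "HOL-Computational_Algebra.Fundamental_Theorem_Algebra"
    "HOL-Analysis.Continuum_Not_Denumerable" "HOL-Analysis.Complex_Transcendental"
begin

text \<open>
  The variety becomes transparent once \<open>t\<close> is eliminated. Let \<open>V \<subseteq> \<complex>\<^sup>n\<close> be the image of
  \<open>t \<mapsto> (g\<^sub>j(t))\<^sub>j\<close> and \<open>W\<close> its annihilator. The critical point equations say \<open>p \<in> W\<close>, and
  \<open>p\<^sub>j = a\<^sub>j / f\<^sub>j(z, t)\<close> says \<open>z\<^sub>j - a\<^sub>j / p\<^sub>j = - g\<^sub>j(t)\<close>; so \<open>\<Lambda>\<close> is given in the ambient space by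
  \<open>p \<in> W\<close> and \<open>z - a/p \<in> V\<close>. The functions \<open>F\<^sub>I(p)\<close> express the first condition. Since \<open>F\<^sub>I(z, p)\<close>
  is the product of the \<open>p\<^sub>i\<close>, \<open>i \<in> I\<close>, times the linear form \<open>f\<^sub>I\<close> evaluated at \<open>z - a/p\<close>
  (\<open>F_circuit_eq\<close>), and the forms \<open>f\<^sub>I\<close> cut out \<open>V\<close>, the functions \<open>F\<^sub>I(z, p)\<close> express the second.

  As the minor of the first \<open>k\<close> rows of \<open>b\<close> is nonzero, \<open>V\<close> is the graph of a linear map over the
  first \<open>k\<close> coordinates; \<open>proj\<close> is the resulting projection onto \<open>V\<close> and \<open>dual\<close> its transpose.
  The \<open>n\<close> equations \<open>dual p i = 0\<close> (\<open>i < k\<close>) and \<open>(1 - proj) (z - a/p) j = 0\<close> (\<open>j \<ge> k\<close>) are, up to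
  units, among the generators. They have independent differentials and exhibit \<open>\<Lambda>\<close> as
  the part, inside the ambient space, of the image under \<open>lift\<close> of the affine space of all \<open>(z, p)\<close>
  with \<open>p \<in> W\<close>; it is a graph over \<open>p\<close> and the first \<open>k\<close> coordinates of \<open>z\<close>. Smoothness follows, and irreducibility too once \<open>\<Lambda>\<close> is seen to be nonempty (\<open>Lambda_nonempty\<close>); this is
  where \<open>|a| \<noteq> 0\<close> enters, for \<open>n = k + 1\<close>. In the coordinates \<open>(z - a/p, p)\<close>, which are
  symplectic because \<open>d(a\<^sub>j/p\<^sub>j) \<and> dp\<^sub>j = 0\<close>, the tangent space is \<open>V \<times> W\<close>, hence Lagrangian.

  For the ideals, let \<open>\<phi>\<close> be regular and zero on \<open>\<Lambda>\<close>. Near each point \<open>\<phi>\<close> is a quotient of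
  polynomials \<open>G / H\<close>. Modulo the generators \<open>G\<close> can be rewritten, up to a power of
  \<open>p\<^sub>1 \<cdots> p\<^sub>n\<close>, as a polynomial on the affine space just mentioned; it vanishes on a nonempty open
  set and is therefore zero (\<open>poly_vanishing_on_Lambda_in_ideal\<close>). So \<open>\<phi>\<close> lies in the ideal locally.
  The passage to the global statement (\<open>locally_in_ideal_imp_in_ideal\<close>) needs the weak
  Nullstellensatz; over the uncountable field \<open>\<complex>\<close> it follows from a comparison of dimensions:
  a finitely generated algebra has countable dimension, whereas for an element \<open>g\<close> taking no value
  modulo a proper ideal the inverses of \<open>g - c\<close>, \<open>c \<in> \<complex>\<close>, would be uncountably many and linearly
  independent.
\<close>

unbundle no vec_syntax

section \<open>The weak Nullstellensatz over the complex numbers\<close>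

inductive_set fun_algebra :: "('x \<Rightarrow> complex) set \<Rightarrow> ('x \<Rightarrow> complex) set"
  for G :: "('x \<Rightarrow> complex) set" where
  const: "(\<lambda>_. c) \<in> fun_algebra G"
| gen: "g \<in> G \<Longrightarrow> g \<in> fun_algebra G"
| add: "f \<in> fun_algebra G \<Longrightarrow> g \<in> fun_algebra G \<Longrightarrow> (\<lambda>x. f x + g x) \<in> fun_algebra G"
| mult: "f \<in> fun_algebra G \<Longrightarrow> g \<in> fun_algebra G \<Longrightarrow> (\<lambda>x. f x * g x) \<in> fun_algebra G"

text \<open>Algebras and their ideals are plain sets of total functions: elements of the polynomial ring,
  of a localisation and of the ring of regular functions can then be multiplied directly.\<close>

definition fun_ideal :: "('x \<Rightarrow> complex) set \<Rightarrow> ('x \<Rightarrow> complex) set \<Rightarrow> bool" where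
  "fun_ideal A I \<longleftrightarrow> I \<subseteq> A \<and> (\<lambda>_. 0) \<in> I \<and> (\<forall>f\<in>I. \<forall>g\<in>I. (\<lambda>x. f x + g x) \<in> I) \<and>
     (\<forall>f\<in>A. \<forall>g\<in>I. (\<lambda>x. f x * g x) \<in> I)"

lemma fun_ideal_add: "fun_ideal A I \<Longrightarrow> f \<in> I \<Longrightarrow> g \<in> I \<Longrightarrow> (\<lambda>x. f x + g x) \<in> I"
  and fun_ideal_mult: "fun_ideal A I \<Longrightarrow> f \<in> A \<Longrightarrow> g \<in> I \<Longrightarrow> (\<lambda>x. f x * g x) \<in> I"
  and fun_ideal_zero: "fun_ideal A I \<Longrightarrow> (\<lambda>_. 0) \<in> I"
  by (auto simp: fun_ideal_def)

lemma fun_ideal_sum: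
  assumes "fun_ideal A I" "\<And>i. i \<in> S \<Longrightarrow> f i \<in> I"
  shows "(\<lambda>x. \<Sum>i\<in>S. f i x) \<in> I"
  using assms(2)
  by (induction S rule: infinite_finite_induct)
    (auto intro: fun_ideal_add[OF assms(1)] fun_ideal_zero[OF assms(1)])

lemma vector_space_complex_functions:
  "vector_space (\<lambda>(c::complex) (f::'x \<Rightarrow> complex). (\<lambda>x. c * f x))"
  by unfold_locales (auto simp: fun_eq_iff algebra_simps)

definition monomials :: "('x \<Rightarrow> complex) set \<Rightarrow> ('x \<Rightarrow> complex) set" where
  "monomials G = (\<lambda>gs x. prod_list (map (\<lambda>g. g x) gs)) ` lists G"

lemma fun_algebra_spanned_by_monomials:
  fixes G :: "('x \<Rightarrow> complex) set"
  assumes "f \<in> fun_algebra G"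
  shows "f \<in> module.span (\<lambda>c f. (\<lambda>x. c * f x)) (monomials G)"
proof -
  interpret V: vector_space "\<lambda>(c::complex) (f::'x \<Rightarrow> complex). (\<lambda>x. c * f x)"
    by (rule vector_space_complex_functions)
  have mult_monomial: "(\<lambda>x. f x * m x) \<in> V.span (monomials G)"
    if "f \<in> V.span (monomials G)" "m \<in> monomials G" for f m
    using that(1)
  proof (induction rule: V.span_induct_alt)
    case base
    have "(\<lambda>x. 0 x * m x) = (0 :: 'x \<Rightarrow> complex)" by auto
    then show ?case by (metis V.span_zero)
  next
    case (step c m' f)
    from step(1) that(2) obtain gs hs where gs: "gs \<in> lists G" "hs \<in> lists G"
      and m: "m' = (\<lambda>x. prod_list (map (\<lambda>g. g x) gs))" "m = (\<lambda>x. prod_list (map (\<lambda>g. g x) hs))"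
      by (auto simp: monomials_def)
    have "(\<lambda>x. m' x * m x) = (\<lambda>x. prod_list (map (\<lambda>g. g x) (gs @ hs)))"
      by (simp add: m)
    also have "\<dots> \<in> monomials G"
      unfolding monomials_def by (rule imageI) (use gs in auto)
    finally have "(\<lambda>x. m' x * m x) \<in> V.span (monomials G)" by (rule V.span_base)
    from V.span_add[OF V.span_scale[OF this, of c] step(2)]
    show ?case by (auto simp: algebra_simps plus_fun_def)
  qed
  have span_mult: "(\<lambda>x. f x * g x) \<in> V.span (monomials G)"
    if "g \<in> V.span (monomials G)" "f \<in> V.span (monomials G)" for f g
    using that(1)
  proof (induction rule: V.span_induct_alt)
    case base
    have "(\<lambda>x. f x * 0 x) = (0 :: 'x \<Rightarrow> complex)" by auto
    then show ?case by (metis V.span_zero)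
  next
    case (step c m g)
    from V.span_add[OF V.span_scale[OF mult_monomial[OF that(2) step(1)], of c] step(2)]
    show ?case by (auto simp: algebra_simps plus_fun_def)
  qed
  from assms show ?thesis
  proof induction
    case (const c)
    have "(\<lambda>x. prod_list (map (\<lambda>g. g x) [])) \<in> monomials G"
      unfolding monomials_def by (rule imageI) auto
    from V.span_scale[OF V.span_base[OF this], of c] show ?case by simp
  next
    case (gen g)
    have "(\<lambda>x. prod_list (map (\<lambda>g. g x) [g])) \<in> monomials G"
      unfolding monomials_def by (rule imageI) (use gen in auto)
    from V.span_base[OF this] show ?case by simp
  next
    case (add f g)
    from V.span_add[OF add(3,4)] show ?case by (simp add: plus_fun_def)
  next
    case (mult f g)
    then show ?case by (intro span_mult)
  qed
qed

lemma countable_monomials: "finite G \<Longrightarrow> countable (monomials G)"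
  by (simp add: monomials_def countable_finite)

lemma uncountable_complex: "uncountable (UNIV :: complex set)"
proof
  assume "countable (UNIV :: complex set)"
  then have "countable (range complex_of_real)" by (rule countable_subset[rotated]) auto
  then have "countable (UNIV :: real set)"
    by (rule countable_image_inj_on) (auto simp: inj_on_def)
  then show False using uncountable_UNIV_real by simp
qed

text \<open>A finitely generated algebra is spanned by countably many monomials, whereas \<open>\<complex>\<close> is
  uncountable: infinitely many members of the family lie in the span of the same finite set.\<close>

lemma linear_relation_in_uncountable_family:
  fixes y :: "complex \<Rightarrow> 'x \<Rightarrow> complex"
  assumes G: "finite G" and y: "\<And>c. y c \<in> fun_algebra G" and "inj y"
  shows "\<exists>C u. finite C \<and> (\<exists>c\<in>C. u c \<noteq> 0) \<and> (\<forall>x. (\<Sum>c\<in>C. u c * y c x) = 0)"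
proof -
  interpret V: vector_space "\<lambda>(c::complex) (f::'x \<Rightarrow> complex). (\<lambda>x. c * f x)"
    by (rule vector_space_complex_functions)
  have "\<exists>T. finite T \<and> T \<subseteq> monomials G \<and> y c \<in> V.span T" for c
  proof -
    obtain T r where T: "finite T" "T \<subseteq> monomials G" "y c = (\<Sum>a\<in>T. (\<lambda>x. r a * a x))"
      using fun_algebra_spanned_by_monomials[OF y, of c] unfolding V.span_explicit by blast
    have "y c \<in> V.span T"
      unfolding T(3) by (intro V.span_sum V.span_scale V.span_base)
    with T show ?thesis by blast
  qed
  then obtain T where T: "\<And>c. finite (T c)" "\<And>c. T c \<subseteq> monomials G" "\<And>c. y c \<in> V.span (T c)"
    by metis
  have "countable (range T)"
    by (rule countable_subset[OF _ countable_Collect_finite_subset[OF countable_monomials[OF G]]])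
      (use T in auto)
  moreover have "UNIV = (\<Union>S\<in>range T. {c. T c = S})" by auto
  ultimately obtain S where "S \<in> range T" and inf: "infinite {c. T c = S}"
    using uncountable_complex countable_finite by (metis (no_types, lifting) countable_UN)
  then have "finite S" using T(1) by auto
  have "infinite (y ` {c. T c = S})"
    using inf \<open>inj y\<close> by (meson finite_imageD inj_on_subset subset_UNIV)
  moreover have "y ` {c. T c = S} \<subseteq> V.span S" using T(3) by auto
  ultimately have "V.dependent (y ` {c. T c = S})"
    using V.independent_span_bound[OF \<open>finite S\<close>] by blast
  then obtain t u where t: "finite t" "t \<subseteq> y ` {c. T c = S}" "(\<Sum>v\<in>t. (\<lambda>x. u v * v x)) = 0"
    "\<exists>v\<in>t. u v \<noteq> 0"
    unfolding V.dependent_explicit by blast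
  define C where "C = {c. y c \<in> t}"
  have yC: "y ` C = t" using t(2) by (auto simp: C_def)
  have injC: "inj_on y C" using \<open>inj y\<close> by (rule inj_on_subset) simp
  have fC: "finite C" using finite_imageD[OF _ injC] t(1) yC by simp
  have "(\<Sum>c\<in>C. u (y c) * y c x) = 0" for x
  proof -
    have "(\<Sum>c\<in>C. u (y c) * y c x) = (\<Sum>v\<in>t. u v * v x)"
      unfolding yC[symmetric] by (simp add: sum.reindex[OF injC])
    also have "\<dots> = (\<Sum>v\<in>t. (\<lambda>x. u v * v x)) x"
      using t(1) by (induction t) auto
    finally show ?thesis using t(3) by simp
  qed
  moreover have "\<exists>c\<in>C. u (y c) \<noteq> 0" using t(4) yC by auto
  ultimately show ?thesis using fC by (intro exI[of _ C] exI[of _ "\<lambda>c. u (y c)"]) simp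
qed

lemma fun_algebra_diff:
  assumes "f \<in> fun_algebra G" "g \<in> fun_algebra G"
  shows "(\<lambda>x. f x - g x) \<in> fun_algebra G"
  using fun_algebra.add[OF assms(1) fun_algebra.mult[OF fun_algebra.const[of "-1"] assms(2)]]
  by simp

lemma fun_algebra_poly:
  assumes "g \<in> fun_algebra G"
  shows "(\<lambda>x. poly P (g x)) \<in> fun_algebra G"
  by (induction P) (auto intro!: fun_algebra.const fun_algebra.add fun_algebra.mult assms)

lemma fun_ideal_diff:
  assumes "fun_ideal (fun_algebra G) I" "f \<in> I" "g \<in> I"
  shows "(\<lambda>x. f x - g x) \<in> I"
  using fun_ideal_add[OF assms(1,2) fun_ideal_mult[OF assms(1) fun_algebra.const[of "-1"] assms(3)]]
  by simp

text \<open>Modulo \<open>I\<close>, a polynomial in \<open>g\<close> is a product of units \<open>g - c\<close>.\<close>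

lemma poly_of_invertibles_not_in_proper_ideal:
  assumes I: "fun_ideal (fun_algebra G) I" and g: "g \<in> fun_algebra G"
    and y: "\<And>c. y c \<in> fun_algebra G" "\<And>c. (\<lambda>x. (g x - c) * y c x - 1) \<in> I"
    and "P \<noteq> 0" and "(\<lambda>x. poly P (g x)) \<in> I"
  shows "(\<lambda>_. 1) \<in> I"
  using assms(5,6)
proof (induction "degree P" arbitrary: P)
  case 0
  then obtain c where "P = [:c:]" by (metis degree_eq_zeroE)
  with 0 have "(\<lambda>_. c) \<in> I" "c \<noteq> 0" by auto
  from fun_ideal_mult[OF I fun_algebra.const[of "1 / c"] this(1)] this(2)
  show ?case by simp
next
  case (Suc d)
  then have "\<not> constant (poly P)" by (simp add: constant_degree)
  then obtain c where "poly P c = 0" using fundamental_theorem_of_algebra by blast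
  then obtain Q where Q: "P = [:- c, 1:] * Q" by (auto simp: poly_eq_0_iff_dvd)
  have "Q \<noteq> 0" using Suc.prems(1) Q by auto
  moreover have "degree Q = d"
    using Suc.hyps(2) \<open>Q \<noteq> 0\<close> unfolding Q by (subst (asm) degree_mult_eq) auto
  moreover have "(\<lambda>x. poly Q (g x)) \<in> I"
  proof -
    have "(\<lambda>x. y c x * poly P (g x) - poly Q (g x) * ((g x - c) * y c x - 1)) \<in> I"
      using fun_ideal_diff[OF I fun_ideal_mult[OF I y(1) Suc.prems(2)]
          fun_ideal_mult[OF I fun_algebra_poly[OF g] y(2)]] by simp
    also have "(\<lambda>x. y c x * poly P (g x) - poly Q (g x) * ((g x - c) * y c x - 1)) = (\<lambda>x. poly Q (g x))"
      by (auto simp: Q algebra_simps)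
    finally show ?thesis .
  qed
  ultimately show ?case using Suc.hyps(1)[of Q] by blast
qed

text \<open>Otherwise every \<open>g - c\<close> would be invertible modulo \<open>I\<close>. The inverses are distinct elements of a
  space of countable dimension, so finitely many of them satisfy a linear relation, and this turns
  into a polynomial equation for \<open>g\<close> modulo \<open>I\<close>.\<close>

lemma proper_ideal_extend:
  assumes G: "finite G" and I: "fun_ideal (fun_algebra G) I" "(\<lambda>_. 1) \<notin> I"
    and g: "g \<in> fun_algebra G"
  shows "\<exists>c I'. fun_ideal (fun_algebra G) I' \<and> (\<lambda>_. 1) \<notin> I' \<and> I \<subseteq> I' \<and> (\<lambda>x. g x - c) \<in> I'"
proof -
  let ?A = "fun_algebra G"
  define I' where "I' c = {(\<lambda>x. f x + (g x - c) * y x) | f y. f \<in> I \<and> y \<in> ?A}" for c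
  have gc: "(\<lambda>x. g x - c) \<in> ?A" for c by (intro fun_algebra_diff g fun_algebra.const)
  have IA: "I \<subseteq> ?A" using I(1) by (simp add: fun_ideal_def)
  have ideal: "fun_ideal ?A (I' c)" for c
    unfolding fun_ideal_def
  proof (intro conjI ballI)
    show "I' c \<subseteq> ?A"
      using IA gc[of c] by (auto simp: I'_def intro!: fun_algebra.add fun_algebra.mult)
    show "(\<lambda>_. 0) \<in> I' c"
      unfolding I'_def
      by (rule CollectI, rule exI[of _ "\<lambda>_. 0"], rule exI[of _ "\<lambda>_. 0"])
        (use fun_ideal_zero[OF I(1)] fun_algebra.const in auto)
  next
    fix f1 f2 assume "f1 \<in> I' c" "f2 \<in> I' c"
    then obtain h1 y1 h2 y2 where *: "f1 = (\<lambda>x. h1 x + (g x - c) * y1 x)" "h1 \<in> I" "y1 \<in> ?A"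
      "f2 = (\<lambda>x. h2 x + (g x - c) * y2 x)" "h2 \<in> I" "y2 \<in> ?A" by (auto simp: I'_def)
    show "(\<lambda>x. f1 x + f2 x) \<in> I' c"
      unfolding I'_def
      by (rule CollectI, rule exI[of _ "\<lambda>x. h1 x + h2 x"], rule exI[of _ "\<lambda>x. y1 x + y2 x"])
        (use * fun_ideal_add[OF I(1)] fun_algebra.add in \<open>auto simp: algebra_simps\<close>)
  next
    fix f1 f2 assume "f1 \<in> ?A" "f2 \<in> I' c"
    then obtain h2 y2 where *: "f2 = (\<lambda>x. h2 x + (g x - c) * y2 x)" "h2 \<in> I" "y2 \<in> ?A"
      by (auto simp: I'_def)
    show "(\<lambda>x. f1 x * f2 x) \<in> I' c"
      unfolding I'_def
      by (rule CollectI, rule exI[of _ "\<lambda>x. f1 x * h2 x"], rule exI[of _ "\<lambda>x. f1 x * y2 x"])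
        (use * \<open>f1 \<in> ?A\<close> fun_ideal_mult[OF I(1)] fun_algebra.mult in \<open>auto simp: algebra_simps\<close>)
  qed
  have sub: "I \<subseteq> I' c" for c
  proof
    fix f assume "f \<in> I"
    then show "f \<in> I' c"
      unfolding I'_def
      by (intro CollectI exI[of _ f] exI[of _ "\<lambda>_. 0"]) (auto intro: fun_algebra.const)
  qed
  have mem: "(\<lambda>x. g x - c) \<in> I' c" for c
    unfolding I'_def
    by (intro CollectI exI[of _ "\<lambda>_. 0"] exI[of _ "\<lambda>_. 1"])
      (auto intro: fun_algebra.const fun_ideal_zero[OF I(1)])
  have "\<exists>c. (\<lambda>_. 1) \<notin> I' c"
  proof (rule ccontr)
    assume "\<not> ?thesis"
    then have unit: "(\<lambda>_. 1) \<in> I' c" for c by blast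
    have "\<exists>y. y \<in> ?A \<and> (\<lambda>x. (g x - c) * y x - 1) \<in> I" for c
    proof -
      obtain f y where fy: "f \<in> I" "y \<in> ?A" "(\<lambda>_. 1) = (\<lambda>x. f x + (g x - c) * y x)"
        using unit[of c] unfolding I'_def by blast
      have "(\<lambda>x. (g x - c) * y x - 1) = (\<lambda>x. (-1) * f x)"
      proof
        fix x
        have "(g x - c) * y x = 1 - f x" using fun_cong[OF fy(3), of x] by (simp add: algebra_simps)
        then show "(g x - c) * y x - 1 = (-1) * f x" by simp
      qed
      also have "\<dots> \<in> I" by (rule fun_ideal_mult[OF I(1) fun_algebra.const fy(1)])
      finally show ?thesis using fy(2) by blast
    qed
    then obtain y where y: "\<And>c. y c \<in> ?A" "\<And>c. (\<lambda>x. (g x - c) * y c x - 1) \<in> I"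
      by metis
    have "inj y"
    proof
      fix c d assume eq: "y c = y d"
      show "c = d"
      proof (rule ccontr)
        assume "c \<noteq> d"
        have "(\<lambda>x. ((g x - d) * y d x - 1) - ((g x - c) * y c x - 1)) \<in> I"
          by (rule fun_ideal_diff[OF I(1) y(2) y(2)])
        also have "(\<lambda>x. ((g x - d) * y d x - 1) - ((g x - c) * y c x - 1)) = (\<lambda>x. (c - d) * y c x)"
          by (auto simp: eq algebra_simps)
        finally have "(\<lambda>x. (g x - c) / (c - d) * ((c - d) * y c x)) \<in> I"
          by (rule fun_ideal_mult[OF I(1), rotated])
            (use fun_algebra.mult[OF gc[of c] fun_algebra.const[of "1 / (c - d)"]] in simp)
        from fun_ideal_diff[OF I(1) this y(2)[of c]] \<open>c \<noteq> d\<close> have "(\<lambda>_. 1) \<in> I" by simp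
        with I(2) show False ..
      qed
    qed
    from linear_relation_in_uncountable_family[OF G y(1) this]
    obtain C u where C: "finite C" "\<exists>c\<in>C. u c \<noteq> 0" "\<And>x. (\<Sum>c\<in>C. u c * y c x) = 0"
      by blast
    \<comment> \<open>Clearing the denominators \<open>y c = 1 / (g - c)\<close> from the linear relation leaves a
      polynomial relation for \<open>g\<close> modulo \<open>I\<close>.\<close>
    define P where "P = (\<Sum>c\<in>C. smult (u c) (\<Prod>d\<in>C - {c}. [:- d, 1:]))"
    have poly_P: "poly P w = (\<Sum>c\<in>C. u c * (\<Prod>d\<in>C - {c}. w - d))" for w
      by (simp add: P_def poly_sum poly_prod)
    obtain e where e: "e \<in> C" "u e \<noteq> 0" using C(2) by blast
    have "poly P e = u e * (\<Prod>d\<in>C - {e}. e - d)"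
      unfolding poly_P
    proof (subst sum.remove[OF C(1) e(1)])
      have "(\<Sum>c\<in>C - {e}. u c * (\<Prod>d\<in>C - {c}. e - d)) = 0"
        using e C(1) by (intro sum.neutral) auto
      then show "u e * (\<Prod>d\<in>C - {e}. e - d) + (\<Sum>c\<in>C - {e}. u c * (\<Prod>d\<in>C - {c}. e - d)) =
        u e * (\<Prod>d\<in>C - {e}. e - d)" by simp
    qed
    then have "poly P e \<noteq> 0" using e C(1) by auto
    then have "P \<noteq> 0" by auto
    have prod_mem: "(\<lambda>x. \<Prod>d\<in>D. g x - d) \<in> ?A" for D
      by (induction D rule: infinite_finite_induct) (auto intro!: fun_algebra.const fun_algebra.mult gc)
    have "(\<lambda>x. \<Sum>c\<in>C. (u c * (\<Prod>d\<in>C - {c}. g x - d)) * ((g x - c) * y c x - 1)) \<in> I"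
    proof (rule fun_ideal_sum[OF I(1)])
      fix c assume "c \<in> C"
      show "(\<lambda>x. (u c * (\<Prod>d\<in>C - {c}. g x - d)) * ((g x - c) * y c x - 1)) \<in> I"
        by (rule fun_ideal_mult[OF I(1) fun_algebra.mult[OF fun_algebra.const prod_mem] y(2)])
    qed
    also have "(\<lambda>x. \<Sum>c\<in>C. (u c * (\<Prod>d\<in>C - {c}. g x - d)) * ((g x - c) * y c x - 1)) =
        (\<lambda>x. (-1) * poly P (g x))"
    proof
      fix x
      have "(\<Sum>c\<in>C. (u c * (\<Prod>d\<in>C - {c}. g x - d)) * ((g x - c) * y c x - 1)) =
        (\<Sum>c\<in>C. (\<Prod>d\<in>C. g x - d) * (u c * y c x) - u c * (\<Prod>d\<in>C - {c}. g x - d))"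
        using C(1) by (intro sum.cong refl) (simp add: prod.remove algebra_simps)
      also have "\<dots> = (\<Prod>d\<in>C. g x - d) * (\<Sum>c\<in>C. u c * y c x) - poly P (g x)"
        by (simp add: sum_subtractf sum_distrib_left poly_P)
      finally show "(\<Sum>c\<in>C. (u c * (\<Prod>d\<in>C - {c}. g x - d)) * ((g x - c) * y c x - 1)) =
        (-1) * poly P (g x)" by (simp add: C(3))
    qed
    finally have "(\<lambda>x. (-1) * ((-1) * poly P (g x))) \<in> I"
      by (rule fun_ideal_mult[OF I(1) fun_algebra.const])
    then have "(\<lambda>x. poly P (g x)) \<in> I" by simp
    with poly_of_invertibles_not_in_proper_ideal[OF I(1) g y \<open>P \<noteq> 0\<close>] I(2) show False by blast
  qed
  with ideal sub mem show ?thesis by blast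
qed

text \<open>The values \<open>c\<close> are chosen for one generator after the other. They are the coordinates of a
  common zero of \<open>I\<close>, in the space with one coordinate for each generator.\<close>

lemma weak_nullstellensatz:
  assumes G: "finite G" and I: "fun_ideal (fun_algebra G) I" "(\<lambda>_. 1) \<notin> I"
  shows "\<exists>c I'. fun_ideal (fun_algebra G) I' \<and> (\<lambda>_. 1) \<notin> I' \<and> I \<subseteq> I' \<and>
    (\<forall>g\<in>G. (\<lambda>x. g x - c g) \<in> I')"
proof -
  have "\<exists>c I'. fun_ideal (fun_algebra G) I' \<and> (\<lambda>_. 1) \<notin> I' \<and> I \<subseteq> I' \<and>
    (\<forall>g\<in>H. (\<lambda>x. g x - c g) \<in> I')" if "H \<subseteq> G" for H
    using finite_subset[OF that G] that
  proof (induction H rule: finite_induct)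
    case empty
    then show ?case using I by blast
  next
    case (insert h H)
    then obtain c I1 where 1: "fun_ideal (fun_algebra G) I1" "(\<lambda>_. 1) \<notin> I1" "I \<subseteq> I1"
      "\<forall>g\<in>H. (\<lambda>x. g x - c g) \<in> I1" by blast
    from proper_ideal_extend[OF G 1(1,2) fun_algebra.gen[of h]] insert.prems
    obtain d I2 where 2: "fun_ideal (fun_algebra G) I2" "(\<lambda>_. 1) \<notin> I2" "I1 \<subseteq> I2"
      "(\<lambda>x. h x - d) \<in> I2" by blast
    have "\<forall>g\<in>insert h H. (\<lambda>x. g x - (c(h := d)) g) \<in> I2"
      using 1(4) 2(3,4) insert.hyps by auto
    with 1 2 show ?case by (meson order_trans)
  qed
  then show ?thesis by blast
qed

section \<open>Polynomial functions on phase space\<close>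

lemma poly_fun_fst: "j < n \<Longrightarrow> (\<lambda>x. fst x $ j) \<in> poly_fun n"
  and poly_fun_snd: "j < n \<Longrightarrow> (\<lambda>x. snd x $ j) \<in> poly_fun n"
  using poly_fun.coord_z[of j n] poly_fun.coord_p[of j n] by (simp_all add: case_prod_unfold)

lemma poly_fun_cmult: "F \<in> poly_fun n \<Longrightarrow> (\<lambda>x. c * F x) \<in> poly_fun n"
  by (intro poly_fun.mult poly_fun.const)

lemma poly_fun_diff: "F \<in> poly_fun n \<Longrightarrow> G \<in> poly_fun n \<Longrightarrow> (\<lambda>x. F x - G x) \<in> poly_fun n"
  using poly_fun.add[OF _ poly_fun_cmult[of G n "-1"], of F] by simp

lemma poly_fun_sum: "(\<And>i. i \<in> S \<Longrightarrow> F i \<in> poly_fun n) \<Longrightarrow> (\<lambda>x. \<Sum>i\<in>S. F i x) \<in> poly_fun n"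
  by (induction S rule: infinite_finite_induct) (auto intro: poly_fun.const poly_fun.add)

lemma poly_fun_prod: "(\<And>i. i \<in> S \<Longrightarrow> F i \<in> poly_fun n) \<Longrightarrow> (\<lambda>x. \<Prod>i\<in>S. F i x) \<in> poly_fun n"
  by (induction S rule: infinite_finite_induct) (auto intro: poly_fun.const poly_fun.mult)

lemma poly_fun_power: "F \<in> poly_fun n \<Longrightarrow> (\<lambda>x. F x ^ m) \<in> poly_fun n"
  by (induction m) (auto intro: poly_fun.const poly_fun.mult)

lemmas poly_fun_intros = poly_fun.const poly_fun_fst poly_fun_snd poly_fun.add poly_fun_diff
  poly_fun.mult poly_fun_sum poly_fun_prod poly_fun_power

lemma poly_fun_along_polynomial_curve:
  assumes "F \<in> poly_fun n"
    and "\<And>j. j < n \<Longrightarrow> \<exists>P. \<forall>s. fst (\<gamma> s) $ j = poly P s"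
    and "\<And>j. j < n \<Longrightarrow> \<exists>P. \<forall>s. snd (\<gamma> s) $ j = poly P s"
  shows "\<exists>P. \<forall>s. F (\<gamma> s) = poly P s"
  using assms(1)
proof induction
  case (const c)
  show ?case by (rule exI[of _ "[:c:]"]) simp
next
  case (coord_z j)
  then show ?case using assms(2)[of j] by (simp add: case_prod_unfold)
next
  case (coord_p j)
  then show ?case using assms(3)[of j] by (simp add: case_prod_unfold)
next
  case (add F G)
  then show ?case by (metis poly_add)
next
  case (mult F G)
  then show ?case by (metis poly_mult)
qed

definition line_point :: "nat \<Rightarrow> phase_point \<Rightarrow> phase_point \<Rightarrow> complex \<Rightarrow> phase_point" where
  "line_point n x y s = (vec n (\<lambda>j. fst x $ j + s * (fst y $ j - fst x $ j)),
                   vec n (\<lambda>j. snd x $ j + s * (snd y $ j - snd x $ j)))"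

lemma line_point_ends:
  assumes "x \<in> phase_space n" "y \<in> phase_space n"
  shows "line_point n x y 0 = x" "line_point n x y 1 = y"
  using assms by (auto simp: line_point_def phase_space_def)

lemma poly_fun_along_line:
  assumes "F \<in> poly_fun n"
  shows "\<exists>P. \<forall>s. F (line_point n x y s) = poly P s"
proof (rule poly_fun_along_polynomial_curve[OF assms])
  fix j assume "j < n"
  then show "\<exists>P. \<forall>s. fst (line_point n x y s) $ j = poly P s"
    by (intro exI[of _ "[:fst x $ j, fst y $ j - fst x $ j:]"]) (simp add: line_point_def)
  show "\<exists>P. \<forall>s. snd (line_point n x y s) $ j = poly P s"
    using \<open>j < n\<close>
    by (intro exI[of _ "[:snd x $ j, snd y $ j - snd x $ j:]"]) (simp add: line_point_def)
qed

text \<open>An affine space is irreducible: along the line joining two of its points, a polynomial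
  function which is nonzero at one of the two ends has only finitely many zeros.\<close>

lemma common_nonzero_point:
  assumes "finite \<F>" "\<F> \<subseteq> poly_fun n" "S \<subseteq> phase_space n" "S \<noteq> {}"
    and line: "\<And>x y s. x \<in> S \<Longrightarrow> y \<in> S \<Longrightarrow> line_point n x y s \<in> S"
    and "\<And>F. F \<in> \<F> \<Longrightarrow> \<exists>x\<in>S. F x \<noteq> 0"
  shows "\<exists>x\<in>S. \<forall>F\<in>\<F>. F x \<noteq> 0"
  using assms(1,2,6)
proof (induction \<F> rule: finite_induct)
  case empty
  then show ?case using \<open>S \<noteq> {}\<close> by auto
next
  case (insert F \<F>)
  have "\<exists>x\<in>S. \<forall>F\<in>\<F>. F x \<noteq> 0"
  proof (rule insert.IH)
    show "\<F> \<subseteq> poly_fun n" using insert.prems(1) by simp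
    show "\<exists>x\<in>S. G x \<noteq> 0" if "G \<in> \<F>" for G using insert.prems(2)[of G] that by blast
  qed
  then obtain x where x: "x \<in> S" "\<forall>F\<in>\<F>. F x \<noteq> 0" by blast
  obtain y where y: "y \<in> S" "F y \<noteq> 0" using insert.prems(2)[of F] by blast
  have xy: "x \<in> phase_space n" "y \<in> phase_space n" using x y \<open>S \<subseteq> phase_space n\<close> by auto
  have fin: "finite {s. G (line_point n x y s) = 0}" if "G \<in> insert F \<F>" for G
  proof -
    have "G \<in> poly_fun n" using insert.prems(1) that by blast
    from poly_fun_along_line[OF this, of x y]
    obtain P where P: "\<forall>s. G (line_point n x y s) = poly P s" ..
    have "poly P 0 \<noteq> 0 \<or> poly P 1 \<noteq> 0"
      using that x(2) y(2) line_point_ends[OF xy] P by (metis insertE)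
    then have "P \<noteq> 0" by auto
    then show ?thesis using poly_roots_finite[of P] by (simp add: P)
  qed
  have "finite (\<Union>G\<in>insert F \<F>. {s. G (line_point n x y s) = 0})"
    using insert.hyps(1) fin by (intro finite_UN_I) auto
  then obtain s where "s \<notin> (\<Union>G\<in>insert F \<F>. {s. G (line_point n x y s) = 0})"
    using ex_new_if_finite[OF infinite_UNIV_char_0[where 'a = complex]] by blast
  then show ?case using line[OF x(1) y(1), of s] by blast
qed

section \<open>Regular functions\<close>

text \<open>Multiplying numerator and denominator of a local representation by a polynomial that
  vanishes outside the open set makes the representation hold everywhere, the denominator
  being allowed to vanish away from the given point.\<close>

lemma regular_on_iff:
  "regular_on n X \<phi> \<longleftrightarrow>
     (\<forall>x\<in>X. \<exists>G\<in>poly_fun n. \<exists>H\<in>poly_fun n. H x \<noteq> 0 \<and> (\<forall>y\<in>X. H y * \<phi> y = G y))"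
proof (intro iffI ballI)
  fix x assume "regular_on n X \<phi>" "x \<in> X"
  then obtain U G H where U: "zariski_open_in n X U" "x \<in> U"
    and GH: "G \<in> poly_fun n" "H \<in> poly_fun n" "\<And>y. y \<in> U \<Longrightarrow> H y \<noteq> 0 \<and> \<phi> y = G y / H y"
    unfolding regular_on_def by blast
  obtain S where S: "S \<subseteq> poly_fun n" "X - U = {y \<in> X. \<forall>F\<in>S. F y = 0}"
    using U(1) unfolding zariski_open_in_def zariski_closed_in_def by blast
  then obtain F where F: "F \<in> S" "F x \<noteq> 0" using U(2) \<open>x \<in> X\<close> by blast
  have "F y * H y * \<phi> y = F y * G y" if "y \<in> X" for y
  proof (cases "y \<in> U")
    case False
    then have "F y = 0" using S(2) F(1) that by blast
    then show ?thesis by simp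
  qed (use GH(3) in simp)
  moreover have "F x * H x \<noteq> 0" using F(2) GH(3)[OF U(2)] by simp
  moreover have "(\<lambda>y. F y * G y) \<in> poly_fun n" "(\<lambda>y. F y * H y) \<in> poly_fun n"
    using S(1) F(1) GH(1,2) by (auto intro: poly_fun.mult)
  ultimately show "\<exists>G\<in>poly_fun n. \<exists>H\<in>poly_fun n. H x \<noteq> 0 \<and> (\<forall>y\<in>X. H y * \<phi> y = G y)"
    by (intro bexI[of _ "\<lambda>y. F y * G y"] bexI[of _ "\<lambda>y. F y * H y"]) auto
next
  assume *: "\<forall>x\<in>X. \<exists>G\<in>poly_fun n. \<exists>H\<in>poly_fun n. H x \<noteq> 0 \<and> (\<forall>y\<in>X. H y * \<phi> y = G y)"
  show "regular_on n X \<phi>"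
    unfolding regular_on_def
  proof
    fix x assume "x \<in> X"
    with * obtain G H where GH: "G \<in> poly_fun n" "H \<in> poly_fun n" "H x \<noteq> 0"
      "\<And>y. y \<in> X \<Longrightarrow> H y * \<phi> y = G y" by blast
    let ?U = "{y \<in> X. H y \<noteq> 0}"
    have "zariski_open_in n X ?U"
      unfolding zariski_open_in_def zariski_closed_in_def
    proof
      have "X - ?U = {y \<in> X. \<forall>F\<in>{H}. F y = 0}" by auto
      then show "\<exists>S\<subseteq>poly_fun n. X - ?U = {y \<in> X. \<forall>F\<in>S. F y = 0}"
        using GH(2) by (intro exI[of _ "{H}"] conjI) simp_all
    qed auto
    moreover have "\<forall>y\<in>?U. H y \<noteq> 0 \<and> \<phi> y = G y / H y"
      using GH(4) by (simp add: nonzero_eq_divide_eq mult.commute)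
    moreover have "x \<in> ?U" using \<open>x \<in> X\<close> GH(3) by simp
    ultimately show "\<exists>U G H. zariski_open_in n X U \<and> x \<in> U \<and> G \<in> poly_fun n \<and> H \<in> poly_fun n \<and>
        (\<forall>y\<in>U. H y \<noteq> 0 \<and> \<phi> y = G y / H y)"
      using GH(1,2) by (intro exI[of _ ?U] exI[of _ G] exI[of _ H] conjI)
  qed
qed

lemma regular_onE:
  assumes "regular_on n X \<phi>" "x \<in> X"
  obtains G H where "G \<in> poly_fun n" "H \<in> poly_fun n" "H x \<noteq> 0" "\<And>y. y \<in> X \<Longrightarrow> H y * \<phi> y = G y"
  using assms unfolding regular_on_iff by blast

lemma regular_on_cong:
  assumes "\<And>x. x \<in> X \<Longrightarrow> \<phi> x = \<psi> x"
  shows "regular_on n X \<phi> \<longleftrightarrow> regular_on n X \<psi>"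
  using assms by (auto simp: regular_on_iff)

lemma regular_on_poly: "F \<in> poly_fun n \<Longrightarrow> regular_on n X F"
  unfolding regular_on_iff
  by (intro ballI bexI[of _ F] bexI[of _ "\<lambda>_. 1"]) (auto intro: poly_fun.const)

lemma regular_on_inverse_poly:
  assumes "H \<in> poly_fun n" "\<And>x. x \<in> X \<Longrightarrow> H x \<noteq> 0"
  shows "regular_on n X (\<lambda>x. 1 / H x)"
  unfolding regular_on_iff
  by (intro ballI bexI[where x = "\<lambda>_. 1" and A = "poly_fun n"] bexI[where x = H]) (use assms in \<open>auto intro: poly_fun.const\<close>)

lemma regular_on_add:
  assumes "regular_on n X \<phi>" "regular_on n X \<psi>"
  shows "regular_on n X (\<lambda>x. \<phi> x + \<psi> x)"
  unfolding regular_on_iff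
proof
  fix x assume "x \<in> X"
  obtain G H where 1: "G \<in> poly_fun n" "H \<in> poly_fun n" "H x \<noteq> 0"
    "\<And>y. y \<in> X \<Longrightarrow> H y * \<phi> y = G y" using regular_onE[OF assms(1) \<open>x \<in> X\<close>] by blast
  obtain G' H' where 2: "G' \<in> poly_fun n" "H' \<in> poly_fun n" "H' x \<noteq> 0"
    "\<And>y. y \<in> X \<Longrightarrow> H' y * \<psi> y = G' y" using regular_onE[OF assms(2) \<open>x \<in> X\<close>] by blast
  have "(H y * H' y) * (\<phi> y + \<psi> y) = H' y * G y + H y * G' y" if "y \<in> X" for y
    using 1(4)[OF that, symmetric] 2(4)[OF that, symmetric] by (simp add: algebra_simps)
  then show "\<exists>G\<in>poly_fun n. \<exists>H\<in>poly_fun n. H x \<noteq> 0 \<and> (\<forall>y\<in>X. H y * (\<phi> y + \<psi> y) = G y)"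
    using 1(1-3) 2(1-3)
    by (intro bexI[of _ "\<lambda>y. H' y * G y + H y * G' y"] bexI[of _ "\<lambda>y. H y * H' y"])
      (auto intro: poly_fun_intros)
qed

lemma regular_on_mult:
  assumes "regular_on n X \<phi>" "regular_on n X \<psi>"
  shows "regular_on n X (\<lambda>x. \<phi> x * \<psi> x)"
  unfolding regular_on_iff
proof
  fix x assume "x \<in> X"
  obtain G H where 1: "G \<in> poly_fun n" "H \<in> poly_fun n" "H x \<noteq> 0"
    "\<And>y. y \<in> X \<Longrightarrow> H y * \<phi> y = G y" using regular_onE[OF assms(1) \<open>x \<in> X\<close>] by blast
  obtain G' H' where 2: "G' \<in> poly_fun n" "H' \<in> poly_fun n" "H' x \<noteq> 0"
    "\<And>y. y \<in> X \<Longrightarrow> H' y * \<psi> y = G' y" using regular_onE[OF assms(2) \<open>x \<in> X\<close>] by blast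
  have "(H y * H' y) * (\<phi> y * \<psi> y) = G y * G' y" if "y \<in> X" for y
    using 1(4)[OF that, symmetric] 2(4)[OF that, symmetric] by (simp add: algebra_simps)
  then show "\<exists>G\<in>poly_fun n. \<exists>H\<in>poly_fun n. H x \<noteq> 0 \<and> (\<forall>y\<in>X. H y * (\<phi> y * \<psi> y) = G y)"
    using 1(1-3) 2(1-3)
    by (intro bexI[of _ "\<lambda>y. G y * G' y"] bexI[of _ "\<lambda>y. H y * H' y"])
      (auto intro: poly_fun_intros)
qed

lemma regular_on_const: "regular_on n X (\<lambda>_. c)"
  by (intro regular_on_poly poly_fun.const)

lemma regular_on_diff:
  "regular_on n X \<phi> \<Longrightarrow> regular_on n X \<psi> \<Longrightarrow> regular_on n X (\<lambda>x. \<phi> x - \<psi> x)"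
  using regular_on_add[OF _ regular_on_mult[OF regular_on_const[of n X "-1"]], of \<phi> \<psi>] by simp

lemma regular_on_sum:
  "(\<And>i. i \<in> S \<Longrightarrow> regular_on n X (\<phi> i)) \<Longrightarrow> regular_on n X (\<lambda>x. \<Sum>i\<in>S. \<phi> i x)"
  by (induction S rule: infinite_finite_induct) (auto intro: regular_on_const regular_on_add)

lemmas regular_on_intros = regular_on_const regular_on_add regular_on_diff regular_on_mult
  regular_on_sum

lemma regular_ring_simps:
  "carrier (regular_ring n X) = {\<phi> \<in> extensional X. regular_on n X \<phi>}"
  "\<phi> \<otimes>\<^bsub>regular_ring n X\<^esub> \<psi> = (\<lambda>x\<in>X. \<phi> x * \<psi> x)"
  "\<phi> \<oplus>\<^bsub>regular_ring n X\<^esub> \<psi> = (\<lambda>x\<in>X. \<phi> x + \<psi> x)"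
  "\<zero>\<^bsub>regular_ring n X\<^esub> = (\<lambda>x\<in>X. 0)"
  "\<one>\<^bsub>regular_ring n X\<^esub> = (\<lambda>x\<in>X. 1)"
  by (simp_all add: regular_ring_def)

lemma regular_on_restrict [simp]: "regular_on n X (restrict \<phi> X) \<longleftrightarrow> regular_on n X \<phi>"
  by (rule regular_on_cong) simp

lemma cring_regular_ring: "cring (regular_ring n X)"
proof (intro cringI abelian_groupI comm_monoidI)
  fix \<phi> assume \<phi>: "\<phi> \<in> carrier (regular_ring n X)"
  then have "regular_on n X (\<lambda>x. - 1 * \<phi> x)"
    unfolding regular_ring_simps by (intro regular_on_intros) auto
  then show "\<exists>\<psi>\<in>carrier (regular_ring n X). \<psi> \<oplus>\<^bsub>regular_ring n X\<^esub> \<phi> = \<zero>\<^bsub>regular_ring n X\<^esub>"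
    unfolding regular_ring_simps
    by (intro bexI[of _ "\<lambda>x\<in>X. - 1 * \<phi> x"]) auto
next
  fix \<phi> \<psi> assume "\<phi> \<in> carrier (regular_ring n X)" "\<psi> \<in> carrier (regular_ring n X)"
  then show "\<phi> \<oplus>\<^bsub>regular_ring n X\<^esub> \<psi> \<in> carrier (regular_ring n X)"
    "\<phi> \<otimes>\<^bsub>regular_ring n X\<^esub> \<psi> \<in> carrier (regular_ring n X)"
    unfolding regular_ring_simps by (auto intro: regular_on_add regular_on_mult)
qed (unfold regular_ring_simps,
  auto simp: fun_eq_iff extensional_def algebra_simps regular_on_const)

text \<open>Forgetting the values outside \<open>X\<close> turns an ideal of the ring of extensional functions into one
  of total functions, for which no restriction has to be carried along.\<close>

lemma fun_ideal_of_ring_ideal: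
  assumes "ideal I (regular_ring n X)"
  shows "fun_ideal {\<phi>. regular_on n X \<phi>} {\<phi>. regular_on n X \<phi> \<and> restrict \<phi> X \<in> I}"
proof -
  interpret ideal I "regular_ring n X" by fact
  show ?thesis
    unfolding fun_ideal_def
  proof (intro conjI ballI)
    show "(\<lambda>_. 0) \<in> {\<phi>. regular_on n X \<phi> \<and> restrict \<phi> X \<in> I}"
      using additive_subgroup.zero_closed[OF is_additive_subgroup]
      by (simp add: regular_ring_simps regular_on_const)
  next
    fix \<phi> \<psi> assume *: "\<phi> \<in> {\<phi>. regular_on n X \<phi> \<and> restrict \<phi> X \<in> I}"
      "\<psi> \<in> {\<phi>. regular_on n X \<phi> \<and> restrict \<phi> X \<in> I}"
    then have "restrict \<phi> X \<oplus>\<^bsub>regular_ring n X\<^esub> restrict \<psi> X \<in> I"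
      by (intro additive_subgroup.a_closed[OF is_additive_subgroup]) auto
    also have "restrict \<phi> X \<oplus>\<^bsub>regular_ring n X\<^esub> restrict \<psi> X = (\<lambda>x\<in>X. \<phi> x + \<psi> x)"
      by (auto simp: regular_ring_simps)
    finally have "(\<lambda>x\<in>X. \<phi> x + \<psi> x) \<in> I" .
    moreover have "regular_on n X (\<lambda>x. \<phi> x + \<psi> x)" using * by (intro regular_on_add) auto
    ultimately show "(\<lambda>x. \<phi> x + \<psi> x) \<in> {\<phi>. regular_on n X \<phi> \<and> restrict \<phi> X \<in> I}" by blast
  next
    fix \<phi> \<psi> assume *: "\<phi> \<in> {\<phi>. regular_on n X \<phi>}"
      "\<psi> \<in> {\<phi>. regular_on n X \<phi> \<and> restrict \<phi> X \<in> I}"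
    then have "restrict \<phi> X \<otimes>\<^bsub>regular_ring n X\<^esub> restrict \<psi> X \<in> I"
      by (intro I_l_closed) (auto simp: regular_ring_simps)
    also have "restrict \<phi> X \<otimes>\<^bsub>regular_ring n X\<^esub> restrict \<psi> X = (\<lambda>x\<in>X. \<phi> x * \<psi> x)"
      by (auto simp: regular_ring_simps)
    finally have "(\<lambda>x\<in>X. \<phi> x * \<psi> x) \<in> I" .
    moreover have "regular_on n X (\<lambda>x. \<phi> x * \<psi> x)" using * by (intro regular_on_mult) auto
    ultimately show "(\<lambda>x. \<phi> x * \<psi> x) \<in> {\<phi>. regular_on n X \<phi> \<and> restrict \<phi> X \<in> I}" by blast
  qed auto
qed

lemma ideal_vanishing_ideal:
  assumes "Y \<subseteq> X"
  shows "ideal (vanishing_ideal n X Y) (regular_ring n X)"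
proof -
  interpret cring "regular_ring n X" by (rule cring_regular_ring)
  have inv: "\<ominus>\<^bsub>regular_ring n X\<^esub> \<phi> = (\<lambda>x\<in>X. - \<phi> x)" if "\<phi> \<in> carrier (regular_ring n X)" for \<phi>
  proof (rule minus_equality)
    show "(\<lambda>x\<in>X. - \<phi> x) \<oplus>\<^bsub>regular_ring n X\<^esub> \<phi> = \<zero>\<^bsub>regular_ring n X\<^esub>"
      by (auto simp: regular_ring_simps)
    have "regular_on n X (\<lambda>x. - 1 * \<phi> x)"
      using that unfolding regular_ring_simps by (intro regular_on_intros) auto
    then show "(\<lambda>x\<in>X. - \<phi> x) \<in> carrier (regular_ring n X)"
      by (simp add: regular_ring_simps)
  qed (rule that)
  show ?thesis
  proof (rule idealI)
    show "subgroup (vanishing_ideal n X Y) (add_monoid (regular_ring n X))"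
    proof (rule add.subgroupI)
      show "vanishing_ideal n X Y \<subseteq> carrier (regular_ring n X)" by (auto simp: vanishing_ideal_def)
      have "\<zero>\<^bsub>regular_ring n X\<^esub> \<in> vanishing_ideal n X Y"
        unfolding vanishing_ideal_def using assms by (auto simp: regular_ring_simps regular_on_const)
      then show "vanishing_ideal n X Y \<noteq> {}" by blast
    next
      fix \<phi> assume "\<phi> \<in> vanishing_ideal n X Y"
      then show "\<ominus>\<^bsub>regular_ring n X\<^esub> \<phi> \<in> vanishing_ideal n X Y"
        using assms inv[of \<phi>] a_inv_closed[of \<phi>] by (auto simp: vanishing_ideal_def)
    next
      fix \<phi> \<psi> assume "\<phi> \<in> vanishing_ideal n X Y" "\<psi> \<in> vanishing_ideal n X Y"
      then show "\<phi> \<oplus>\<^bsub>regular_ring n X\<^esub> \<psi> \<in> vanishing_ideal n X Y"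
        using assms a_closed[of \<phi> \<psi>] by (auto simp: vanishing_ideal_def regular_ring_simps)
    qed
  next
    fix \<phi> \<psi> assume *: "\<phi> \<in> vanishing_ideal n X Y" "\<psi> \<in> carrier (regular_ring n X)"
    then show "\<psi> \<otimes>\<^bsub>regular_ring n X\<^esub> \<phi> \<in> vanishing_ideal n X Y"
      "\<phi> \<otimes>\<^bsub>regular_ring n X\<^esub> \<psi> \<in> vanishing_ideal n X Y"
      using assms m_closed[of \<phi> \<psi>] m_closed[of \<psi> \<phi>]
      by (auto simp: vanishing_ideal_def regular_ring_simps)
  qed (rule ring_axioms)
qed

text \<open>The polynomials \<open>H\<close> with \<open>H \<phi> \<in> J\<close> have no common zero on \<open>X\<close>, so by the
  Nullstellensatz they generate the unit ideal of the coordinate ring \<open>\<complex>[z, p, 1/D]\<close> of \<open>X\<close>.\<close>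

lemma locally_in_ideal_imp_in_ideal:
  assumes D: "D \<in> poly_fun n" and X: "X = {x \<in> phase_space n. D x \<noteq> 0}"
    and J: "fun_ideal {\<phi>. regular_on n X \<phi>} J"
    and J_cong: "\<And>\<phi> \<psi>. \<phi> \<in> J \<Longrightarrow> (\<And>x. x \<in> X \<Longrightarrow> \<phi> x = \<psi> x) \<Longrightarrow> \<psi> \<in> J"
    and local: "\<And>x. x \<in> X \<Longrightarrow> \<exists>H\<in>poly_fun n. H x \<noteq> 0 \<and> (\<lambda>y. H y * \<phi> y) \<in> J"
  shows "\<phi> \<in> J"
proof -
  define zs where "zs j = (\<lambda>x::phase_point. fst x $ j)" for j
  define ps where "ps j = (\<lambda>x::phase_point. snd x $ j)" for j
  define w where "w = (\<lambda>x. 1 / D x)"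
  define G where "G = zs ` {..<n} \<union> ps ` {..<n} \<union> {w}"
  have G: "finite G" by (simp add: G_def)
  have poly_alg: "F \<in> fun_algebra G" if "F \<in> poly_fun n" for F
    using that
  proof induction
    case (coord_z j)
    then have "zs j \<in> G" by (simp add: G_def)
    then show ?case using fun_algebra.gen[of "zs j" G] by (simp add: zs_def case_prod_unfold)
  next
    case (coord_p j)
    then have "ps j \<in> G" by (simp add: G_def)
    then show ?case using fun_algebra.gen[of "ps j" G] by (simp add: ps_def case_prod_unfold)
  qed (auto intro: fun_algebra.const fun_algebra.add fun_algebra.mult)
  have alg_regular: "regular_on n X f" if "f \<in> fun_algebra G" for f
    using that
  proof induction
    case (gen g)
    then show ?case
      using D by (auto simp: G_def zs_def ps_def w_def X
        intro: regular_on_poly poly_fun_fst poly_fun_snd regular_on_inverse_poly)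
  qed (auto intro: regular_on_intros)
  define I where "I = {f \<in> fun_algebra G. (\<lambda>x. f x * \<phi> x) \<in> J}"
  have I: "fun_ideal (fun_algebra G) I"
    unfolding fun_ideal_def
  proof (intro conjI ballI)
    show "(\<lambda>_. 0) \<in> I" using fun_ideal_zero[OF J] by (simp add: I_def fun_algebra.const)
  next
    fix f g assume *: "f \<in> I" "g \<in> I"
    with fun_ideal_add[OF J, of "\<lambda>x. f x * \<phi> x" "\<lambda>x. g x * \<phi> x"]
    show "(\<lambda>x. f x + g x) \<in> I" by (simp add: I_def fun_algebra.add algebra_simps)
  next
    fix f g assume *: "f \<in> fun_algebra G" "g \<in> I"
    with fun_ideal_mult[OF J, of f "\<lambda>x. g x * \<phi> x"] alg_regular
    show "(\<lambda>x. f x * g x) \<in> I" by (simp add: I_def fun_algebra.mult mult.assoc)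
  qed (simp add: I_def)
  have "(\<lambda>_. 1) \<in> I"
  proof (rule ccontr)
    assume "(\<lambda>_. 1) \<notin> I"
    from weak_nullstellensatz[OF G I this] obtain c I' where I': "fun_ideal (fun_algebra G) I'"
      "(\<lambda>_. 1) \<notin> I'" "I \<subseteq> I'" and c: "\<And>g. g \<in> G \<Longrightarrow> (\<lambda>x. g x - c g) \<in> I'" by blast
    define x where "x = (vec n (\<lambda>j. c (zs j)), vec n (\<lambda>j. c (ps j)))"
    have val: "(\<lambda>y. F y - F x) \<in> I'" if "F \<in> poly_fun n" for F
      using that
    proof induction
      case (const c)
      then show ?case using fun_ideal_zero[OF I'(1)] by simp
    next
      case (coord_z j)
      then show ?case using c[of "zs j"] by (simp add: G_def x_def zs_def case_prod_unfold)
    next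
      case (coord_p j)
      then show ?case using c[of "ps j"] by (simp add: G_def x_def ps_def case_prod_unfold)
    next
      case (add F1 F2)
      from fun_ideal_add[OF I'(1) add(3,4)] show ?case by (simp add: algebra_simps)
    next
      case (mult F1 F2)
      from fun_ideal_add[OF I'(1) fun_ideal_mult[OF I'(1) poly_alg[OF mult(1)] mult(4)]
          fun_ideal_mult[OF I'(1) fun_algebra.const[of "F2 x"] mult(3)]]
      show ?case by (simp add: algebra_simps)
    qed
    have const_mem: "c = 0" if "(\<lambda>_. c) \<in> I'" for c
      using fun_ideal_mult[OF I'(1) fun_algebra.const[of "1 / c"] that] I'(2) by (cases "c = 0") auto
    have w: "w \<in> fun_algebra G" by (auto intro: fun_algebra.gen simp: G_def)
    have "D x \<noteq> 0"
    proof
      assume "D x = 0"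
      have "(\<lambda>y. (w y * D y - 1) * \<phi> y) \<in> J"
        by (rule J_cong[OF fun_ideal_zero[OF J]]) (simp add: w_def X)
      then have "(\<lambda>y. w y * D y - 1) \<in> I"
        using fun_algebra_diff[OF fun_algebra.mult[OF w poly_alg[OF D]] fun_algebra.const[of 1]]
        by (simp add: I_def)
      with I'(3) have "(\<lambda>y. w y * D y - 1) \<in> I'" by blast
      from fun_ideal_diff[OF I'(1) fun_ideal_mult[OF I'(1) w val[OF D]] this]
      show False using I'(2) \<open>D x = 0\<close> by simp
    qed
    then have "x \<in> X" by (simp add: X x_def phase_space_def)
    then obtain H where H: "H \<in> poly_fun n" "H x \<noteq> 0" "(\<lambda>y. H y * \<phi> y) \<in> J"
      using local by blast
    then have "H \<in> I'" using I'(3) poly_alg by (auto simp: I_def)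
    from fun_ideal_diff[OF I'(1) this val[OF H(1)]] const_mem[of "H x"] H(2)
    show False by simp
  qed
  then show ?thesis by (simp add: I_def)
qed

text \<open>This is how equations solved for some of the coordinates act on a polynomial. The identity
  \<open>F G - F' G' = F (G - G') + G' (F - F')\<close> reduces the claim to the coordinates themselves.\<close>

lemma poly_fun_congruent_substitution:
  assumes J: "fun_ideal {\<phi>. regular_on n X \<phi>} J"
    and reg: "\<And>j. j < n \<Longrightarrow> regular_on n X (\<lambda>x. fst (\<alpha> x) $ j)"
      "\<And>j. j < n \<Longrightarrow> regular_on n X (\<lambda>x. snd (\<alpha> x) $ j)"
    and mem: "\<And>j. j < n \<Longrightarrow> (\<lambda>x. fst x $ j - fst (\<alpha> x) $ j) \<in> J"
      "\<And>j. j < n \<Longrightarrow> (\<lambda>x. snd x $ j - snd (\<alpha> x) $ j) \<in> J"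
    and F: "F \<in> poly_fun n"
  shows "regular_on n X (\<lambda>x. F (\<alpha> x)) \<and> (\<lambda>x. F x - F (\<alpha> x)) \<in> J"
  using F
proof induction
  case (const c)
  then show ?case using fun_ideal_zero[OF J] by (simp add: regular_on_const)
next
  case (coord_z j)
  then show ?case using reg mem by (simp add: case_prod_unfold)
next
  case (coord_p j)
  then show ?case using reg mem by (simp add: case_prod_unfold)
next
  case (add F1 F2)
  from fun_ideal_add[OF J, of "\<lambda>x. F1 x - F1 (\<alpha> x)" "\<lambda>x. F2 x - F2 (\<alpha> x)"] add.IH
  show ?case by (auto intro: regular_on_add simp: algebra_simps)
next
  case (mult F1 F2)
  have "(\<lambda>x. F1 x * (F2 x - F2 (\<alpha> x)) + F2 (\<alpha> x) * (F1 x - F1 (\<alpha> x))) \<in> J"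
    using mult by (intro fun_ideal_add[OF J] fun_ideal_mult[OF J]) (auto intro: regular_on_poly)
  then show ?case using mult by (auto intro: regular_on_mult simp: algebra_simps)
qed

section \<open>Derivatives along curves\<close>

definition curve_at :: "nat \<Rightarrow> (complex \<Rightarrow> phase_point) \<Rightarrow> phase_point \<Rightarrow> phase_point \<Rightarrow> bool" where
  "curve_at n \<gamma> x v \<longleftrightarrow> range \<gamma> \<subseteq> phase_space n \<and> \<gamma> 0 = x \<and>
     (\<forall>j<n. ((\<lambda>s. fst (\<gamma> s) $ j) has_field_derivative fst v $ j) (at 0) \<and>
            ((\<lambda>s. snd (\<gamma> s) $ j) has_field_derivative snd v $ j) (at 0))"

text \<open>The derivative is chosen before the curve: this is what lets a straight line be exchanged for a
  curve inside a variety.\<close>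

lemma poly_fun_derivative:
  assumes "F \<in> poly_fun n"
  shows "\<exists>F'. \<forall>\<gamma>. curve_at n \<gamma> x v \<longrightarrow> ((\<lambda>s. F (\<gamma> s)) has_field_derivative F') (at 0)"
  using assms
proof induction
  case (const c)
  show ?case by (rule exI[of _ 0]) simp
next
  case (coord_z j)
  then show ?case by (intro exI[of _ "fst v $ j"]) (simp add: curve_at_def case_prod_unfold)
next
  case (coord_p j)
  then show ?case by (intro exI[of _ "snd v $ j"]) (simp add: curve_at_def case_prod_unfold)
next
  case (add F G)
  then obtain F' G' where "\<forall>\<gamma>. curve_at n \<gamma> x v \<longrightarrow> ((\<lambda>s. F (\<gamma> s)) has_field_derivative F') (at 0)"
    "\<forall>\<gamma>. curve_at n \<gamma> x v \<longrightarrow> ((\<lambda>s. G (\<gamma> s)) has_field_derivative G') (at 0)" by blast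
  then show ?case by (intro exI[of _ "F' + G'"]) (auto intro: DERIV_add)
next
  case (mult F G)
  then obtain F' G' where FG: "\<forall>\<gamma>. curve_at n \<gamma> x v \<longrightarrow> ((\<lambda>s. F (\<gamma> s)) has_field_derivative F') (at 0)"
    "\<forall>\<gamma>. curve_at n \<gamma> x v \<longrightarrow> ((\<lambda>s. G (\<gamma> s)) has_field_derivative G') (at 0)" by blast
  show ?case
  proof (intro exI[of _ "F' * G x + G' * F x"] allI impI)
    fix \<gamma> assume \<gamma>: "curve_at n \<gamma> x v"
    then have "\<gamma> 0 = x" by (simp add: curve_at_def)
    with DERIV_mult[of "\<lambda>s. F (\<gamma> s)" F' 0 UNIV "\<lambda>s. G (\<gamma> s)" G'] FG \<gamma>
    show "((\<lambda>s. F (\<gamma> s) * G (\<gamma> s)) has_field_derivative F' * G x + G' * F x) (at 0)" by simp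
  qed
qed

lemma poly_fun_eventually_nonzero:
  assumes "F \<in> poly_fun n" "curve_at n \<gamma> x v" "F x \<noteq> 0"
  shows "eventually (\<lambda>s. F (\<gamma> s) \<noteq> 0) (nhds 0)"
proof -
  obtain F' where "((\<lambda>s. F (\<gamma> s)) has_field_derivative F') (at 0)"
    using poly_fun_derivative[OF assms(1)] assms(2) by blast
  then have "isCont (\<lambda>s. F (\<gamma> s)) 0" by (rule DERIV_isCont)
  moreover have "F (\<gamma> 0) \<noteq> 0" using assms(2,3) by (simp add: curve_at_def)
  ultimately have "eventually (\<lambda>s. F (\<gamma> s) \<noteq> 0) (at 0)"
    by (intro tendsto_imp_eventually_ne[of _ "F (\<gamma> 0)"]) (simp_all add: isCont_def)
  then show ?thesis
    unfolding eventually_at_filter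
    by (rule eventually_mono) (use \<open>F (\<gamma> 0) \<noteq> 0\<close> in auto)
qed

lemma curve_at_straight:
  assumes "x \<in> phase_space n" "v \<in> phase_space n"
  shows "curve_at n (\<lambda>s. (fst x + s \<cdot>\<^sub>v fst v, snd x + s \<cdot>\<^sub>v snd v)) x v"
proof -
  have c: "fst x \<in> carrier_vec n" "snd x \<in> carrier_vec n" "fst v \<in> carrier_vec n" "snd v \<in> carrier_vec n"
    using assms by (auto simp: phase_space_def)
  have "((\<lambda>s. y $ j + s * u $ j) has_field_derivative u $ j) (at 0)" for y u :: "complex vec" and j
    by (auto intro!: derivative_eq_intros)
  with c show ?thesis
    by (auto simp: curve_at_def phase_space_def prod_eq_iff)
qed

text \<open>Near \<open>x\<close> the function is a quotient of polynomials, so its derivative along a curve is determined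
  by those of the coordinates. The straight line which defines the differential is one such curve.\<close>

lemma regular_on_chain_rule:
  assumes D: "D \<in> poly_fun n" and X: "X = {x \<in> phase_space n. D x \<noteq> 0}"
    and \<phi>: "regular_on n X \<phi>" and "x \<in> X" "v \<in> phase_space n" and \<gamma>: "curve_at n \<gamma> x v"
  shows "((\<lambda>s. \<phi> (\<gamma> s)) has_field_derivative differential \<phi> x v) (at 0)"
proof -
  have "x \<in> phase_space n" "D x \<noteq> 0" using \<open>x \<in> X\<close> by (auto simp: X)
  obtain G H where GH: "G \<in> poly_fun n" "H \<in> poly_fun n" "H x \<noteq> 0"
    "\<And>y. y \<in> X \<Longrightarrow> H y * \<phi> y = G y" using regular_onE[OF \<phi> \<open>x \<in> X\<close>] by blast
  obtain G' H' where deriv: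
    "\<And>\<gamma>. curve_at n \<gamma> x v \<Longrightarrow> ((\<lambda>s. G (\<gamma> s)) has_field_derivative G') (at 0)"
    "\<And>\<gamma>. curve_at n \<gamma> x v \<Longrightarrow> ((\<lambda>s. H (\<gamma> s)) has_field_derivative H') (at 0)"
    using poly_fun_derivative[OF GH(1)] poly_fun_derivative[OF GH(2)] by metis
  have *: "((\<lambda>s. \<phi> (\<gamma> s)) has_field_derivative (G' * H x - G x * H') / (H x * H x)) (at 0)"
    if \<gamma>: "curve_at n \<gamma> x v" for \<gamma>
  proof -
    have [simp]: "\<gamma> 0 = x" using \<gamma> by (simp add: curve_at_def)
    have "((\<lambda>s. G (\<gamma> s) / H (\<gamma> s)) has_field_derivative (G' * H x - G x * H') / (H x * H x)) (at 0)"
      using DERIV_divide[OF deriv(1)[OF \<gamma>] deriv(2)[OF \<gamma>]] GH(3) by simp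
    moreover have "eventually (\<lambda>s. \<phi> (\<gamma> s) = G (\<gamma> s) / H (\<gamma> s)) (nhds 0)"
      using poly_fun_eventually_nonzero[OF D \<gamma> \<open>D x \<noteq> 0\<close>] poly_fun_eventually_nonzero[OF GH(2) \<gamma> GH(3)]
    proof eventually_elim
      case (elim s)
      then have "\<gamma> s \<in> X" using \<gamma> by (auto simp: X curve_at_def)
      with GH(4)[of "\<gamma> s"] elim show ?case by (simp add: nonzero_eq_divide_eq mult.commute)
    qed
    ultimately show ?thesis by (subst DERIV_cong_ev[OF refl _ refl])
  qed
  have "differential \<phi> x v = (G' * H x - G x * H') / (H x * H x)"
    unfolding differential_def
    by (rule DERIV_imp_deriv, rule *, rule curve_at_straight) fact+
  with *[OF \<gamma>] show ?thesis by simp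
qed

section \<open>Minors and circuits\<close>

lemma length_omit_nth: "m < length is \<Longrightarrow> length (omit_nth m is) = length is - 1"
  by (simp add: omit_nth_def)

lemma nth_omit_nth:
  "m < length is \<Longrightarrow> i < length is - 1 \<Longrightarrow> omit_nth m is ! i = is ! (if i < m then i else Suc i)"
  by (auto simp: omit_nth_def nth_append min_def)

lemma set_omit_nth: "set (omit_nth m is) \<subseteq> set is"
  by (auto simp: omit_nth_def dest: in_set_takeD in_set_dropD)

lemma distinct_omit_nth:
  assumes "distinct is" "m < length is"
  shows "distinct (omit_nth m is)" "is ! m \<notin> set (omit_nth m is)"
proof -
  have "is = take m is @ is ! m # drop (Suc m) is" using assms(2) by (rule id_take_nth_drop)
  then have "distinct (take m is @ is ! m # drop (Suc m) is)" using assms(1) by simp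
  then show "distinct (omit_nth m is)" "is ! m \<notin> set (omit_nth m is)" by (auto simp: omit_nth_def)
qed

text \<open>Laplace expansion along the first row, whose cofactors do not involve that row.\<close>

lemma minor_Cons_linear:
  "\<exists>c. \<forall>j. minor b (j # is) = (\<Sum>l<Suc (length is). b j l * c l)"
proof -
  let ?r = "length is"
  define c where "c l = (-1) ^ l * det (mat ?r ?r (\<lambda>(i, m). b (is ! i) (if m < l then m else Suc m)))"
    for l
  have "minor b (j # is) = (\<Sum>l<Suc ?r. b j l * c l)" for j
  proof -
    define A where "A = mat (Suc ?r) (Suc ?r) (\<lambda>(l, m). b ((j # is) ! l) m)"
    have "minor b (j # is) = det A" by (simp add: minor_def A_def)
    also have "\<dots> = (\<Sum>l<Suc ?r. A $$ (0, l) * cofactor A 0 l)"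
      by (rule laplace_expansion_row) (simp_all add: A_def)
    also have "\<dots> = (\<Sum>l<Suc ?r. b j l * c l)"
    proof (rule sum.cong[OF refl])
      fix l assume "l \<in> {..<Suc ?r}"
      moreover have "mat_delete A 0 l = mat ?r ?r (\<lambda>(i, m). b (is ! i) (if m < l then m else Suc m))"
        by (rule eq_matI) (auto simp: mat_delete_def A_def)
      ultimately show "A $$ (0, l) * cofactor A 0 l = b j l * c l"
        by (simp add: A_def cofactor_def c_def)
    qed
    finally show ?thesis .
  qed
  then show ?thesis by blast
qed

lemma minor_Cons_repeated:
  assumes "i \<in> set is"
  shows "minor b (i # is) = 0"
proof -
  obtain l where l: "l < length is" "is ! l = i" using assms by (auto simp: in_set_conv_nth)
  show ?thesis
    unfolding minor_def
    by (rule det_identical_rows[of _ "length (i # is)" 0 "Suc l"])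
      (use l in \<open>auto intro!: eq_vecI\<close>)
qed

definition circuit_form :: "(nat \<Rightarrow> nat \<Rightarrow> complex) \<Rightarrow> nat list \<Rightarrow> (nat \<Rightarrow> complex) \<Rightarrow> complex" where
  "circuit_form b is y = (\<Sum>m<length is. (-1) ^ m * minor b (omit_nth m is) * y (is ! m))"

lemma f_circuit_eq: "f_circuit b is z = circuit_form b is (\<lambda>j. z $ j)"
  by (simp add: f_circuit_def circuit_form_def)

lemma circuit_form_cong:
  "(\<And>j. j \<in> set is \<Longrightarrow> y j = y' j) \<Longrightarrow> circuit_form b is y = circuit_form b is y'"
  by (auto simp: circuit_form_def)

lemma circuit_form_diff:
  "circuit_form b is (\<lambda>j. y j - y' j) = circuit_form b is y - circuit_form b is y'"
  by (simp add: circuit_form_def sum_subtractf algebra_simps)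

lemma circuit_form_sum:
  "circuit_form b is (\<lambda>j. \<Sum>i\<in>S. y i j) = (\<Sum>i\<in>S. circuit_form b is (y i))"
  unfolding circuit_form_def by (simp add: sum_distrib_left) (rule sum.swap)

lemma circuit_form_cmult: "circuit_form b is (\<lambda>j. y j * c) = circuit_form b is y * c"
  by (simp add: circuit_form_def sum_distrib_right mult.assoc)

text \<open>Laplace expansion, along the first column, of a determinant in which that column is repeated.\<close>

lemma circuit_form_column:
  assumes "length is = Suc k" "l < k"
  shows "circuit_form b is (\<lambda>j. b j l) = 0"
proof -
  define A where "A = mat (Suc k) (Suc k) (\<lambda>(i, c). if c = 0 then b (is ! i) l else b (is ! i) (c - 1))"
  have A: "A \<in> carrier_mat (Suc k) (Suc k)" by (simp add: A_def)
  have "col A 0 = col A (Suc l)"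
    by (rule eq_vecI) (use assms in \<open>auto simp: A_def\<close>)
  then have "det A = 0"
    using det_identical_columns[OF A, of 0 "Suc l"] assms by simp
  moreover have "det A = (\<Sum>m<Suc k. A $$ (m, 0) * cofactor A m 0)"
    by (rule laplace_expansion_column[OF A]) simp
  moreover have "A $$ (m, 0) * cofactor A m 0 = (-1) ^ m * minor b (omit_nth m is) * b (is ! m) l"
    if "m < Suc k" for m
  proof -
    have "mat_delete A m 0 = mat k k (\<lambda>(i, c). b (omit_nth m is ! i) c)"
      by (rule eq_matI) (use assms that in \<open>auto simp: mat_delete_def A_def nth_omit_nth\<close>)
    then show ?thesis
      using that assms by (simp add: A_def cofactor_def minor_def length_omit_nth)
  qed
  ultimately show ?thesis using assms by (simp add: circuit_form_def del: sum.lessThan_Suc)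
qed

definition circuit_vector :: "(nat \<Rightarrow> nat \<Rightarrow> complex) \<Rightarrow> nat list \<Rightarrow> nat \<Rightarrow> complex" where
  "circuit_vector b is j = circuit_form b is (\<lambda>i. if i = j then 1 else 0)"

lemma circuit_vector_nth:
  assumes "distinct is" "m < length is"
  shows "circuit_vector b is (is ! m) = (-1) ^ m * minor b (omit_nth m is)"
proof -
  have "circuit_vector b is (is ! m) =
      (\<Sum>m'<length is. if m' = m then (-1) ^ m' * minor b (omit_nth m' is) else 0)"
    unfolding circuit_vector_def circuit_form_def
    by (rule sum.cong) (use assms in \<open>auto simp: nth_eq_iff_index_eq\<close>)
  then show ?thesis using assms(2) by simp
qed

lemma circuit_vector_outside: "j \<notin> set is \<Longrightarrow> circuit_vector b is j = 0"
  unfolding circuit_vector_def circuit_form_def by (intro sum.neutral) auto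

lemma sum_circuit_vector:
  assumes "set is \<subseteq> {..<n}"
  shows "(\<Sum>j<n. y j * circuit_vector b is j) = circuit_form b is y"
proof -
  have "(\<Sum>j<n. y j * circuit_vector b is j) =
      circuit_form b is (\<lambda>i. \<Sum>j<n. (if i = j then 1 else 0) * y j)"
    unfolding circuit_form_sum circuit_form_cmult
    by (simp add: circuit_vector_def mult.commute)
  also have "\<dots> = circuit_form b is y"
    by (rule circuit_form_cong) (use assms in \<open>auto simp: if_distrib[of "\<lambda>c. c * _"] cong: if_cong\<close>)
  finally show ?thesis .
qed

section \<open>The image of the arrangement and its annihilator\<close>

locale generic_arrangement =
  fixes n k :: nat and a :: "nat \<Rightarrow> complex" and b :: "nat \<Rightarrow> nat \<Rightarrow> complex"
  assumes k_pos: "0 < k" and k_less: "k < n"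
    and minor_nonzero: "\<And>is. length is = k \<Longrightarrow> distinct is \<Longrightarrow> set is \<subseteq> {..<n} \<Longrightarrow> minor b is \<noteq> 0"
    and a_nonzero: "\<And>j. j < n \<Longrightarrow> a j \<noteq> 0"
    and sum_a: "(\<Sum>j<n. a j) \<noteq> 0"
begin

definition in_image :: "(nat \<Rightarrow> complex) \<Rightarrow> bool" where
  "in_image y \<longleftrightarrow> (\<exists>t. \<forall>j<n. y j = (\<Sum>m<k. b j m * t m))"

definition annihilates :: "(nat \<Rightarrow> complex) \<Rightarrow> bool" where
  "annihilates p \<longleftrightarrow> (\<forall>m<k. (\<Sum>j<n. b j m * p j) = 0)"

text \<open>The coefficients expressing row \<open>j\<close> of \<open>b\<close> by its first \<open>k\<close> rows, by Cramer's rule: row \<open>i\<close> is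
  replaced by row \<open>j\<close>. In both minors this row is moved to the front, where the numerator is, up to
  a constant factor, the coefficient of \<open>p\<^sub>j\<close> in a generator.\<close>

definition E :: "nat \<Rightarrow> nat \<Rightarrow> complex" where
  "E j i = minor b (j # omit_nth i [0..<k]) / minor b (i # omit_nth i [0..<k])"

definition proj :: "(nat \<Rightarrow> complex) \<Rightarrow> nat \<Rightarrow> complex" where
  "proj y j = (\<Sum>i<k. E j i * y i)"

definition dual :: "(nat \<Rightarrow> complex) \<Rightarrow> nat \<Rightarrow> complex" where
  "dual p i = (\<Sum>j<n. E j i * p j)"

lemma base_minor_nonzero: "i < k \<Longrightarrow> minor b (i # omit_nth i [0..<k]) \<noteq> 0"
  by (rule minor_nonzero)
    (use k_less set_omit_nth[of i "[0..<k]"] distinct_omit_nth[of "[0..<k]" i]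
      in \<open>auto simp: length_omit_nth\<close>)

lemma E_delta:
  assumes "i < k" "j < k"
  shows "E j i = (if i = j then 1 else 0)"
proof (cases "i = j")
  case True
  then show ?thesis using base_minor_nonzero[OF assms(1)] by (simp add: E_def)
next
  case False
  have "j \<in> set (omit_nth i [0..<k])"
    using False assms by (auto simp: omit_nth_def in_set_conv_nth take_upt drop_upt)
  then show ?thesis using False by (simp add: E_def minor_Cons_repeated)
qed

text \<open>Let \<open>B\<close> be the block of the first \<open>k\<close> rows of \<open>b\<close>. Expansion of the minors along the first row gives
  \<open>E = b C\<close>. The first \<open>k\<close> rows of this equation read \<open>B C = 1\<close>, hence \<open>C B = 1\<close> and \<open>E B = b\<close>.\<close>

lemma E_factorization:
  obtains C where "\<And>j i. i < k \<Longrightarrow> E j i = (\<Sum>l<k. b j l * C l i)"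
    and "\<And>j m. m < k \<Longrightarrow> b j m = (\<Sum>i<k. E j i * b i m)"
proof -
  have "\<exists>c. \<forall>j. E j i = (\<Sum>l<k. b j l * c l)" if i: "i < k" for i
  proof -
    obtain c where c: "\<And>j. minor b (j # omit_nth i [0..<k]) =
        (\<Sum>l<Suc (length (omit_nth i [0..<k])). b j l * c l)"
      using minor_Cons_linear[of b "omit_nth i [0..<k]"] by blast
    have "Suc (length (omit_nth i [0..<k])) = k" using i by (simp add: length_omit_nth)
    then have "minor b (j # omit_nth i [0..<k]) = (\<Sum>l<k. b j l * c l)" for j
      using c[of j] by argo
    then have "E j i = (\<Sum>l<k. b j l * (c l / minor b (i # omit_nth i [0..<k])))" for j
      by (simp only: E_def sum_divide_distrib times_divide_eq_right)
    then show ?thesis by (intro exI[of _ "\<lambda>l. c l / minor b (i # omit_nth i [0..<k])"] allI)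
  qed
  then obtain C' where "\<And>i j. i < k \<Longrightarrow> E j i = (\<Sum>l<k. b j l * C' i l)" by metis
  then have C: "E j i = (\<Sum>l<k. b j l * C' i l)" if "i < k" for i j using that by blast
  define B where "B = mat k k (\<lambda>(i, l). b i l)"
  define M where "M = mat k k (\<lambda>(l, i). C' i l)"
  have "B * M = 1\<^sub>m k"
    by (rule eq_matI)
      (auto simp: B_def M_def scalar_prod_def C[symmetric] E_delta atLeast0LessThan)
  then have MB: "M * B = 1\<^sub>m k"
    by (rule mat_mult_left_right_inverse[rotated 2]) (simp_all add: B_def M_def)
  have inv: "(\<Sum>i<k. C' i l * b i m) = (if l = m then 1 else 0)" if "l < k" "m < k" for l m
    using that arg_cong[OF MB, of "\<lambda>A. A $$ (l, m)"]
    by (simp add: B_def M_def scalar_prod_def atLeast0LessThan)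
  have "b j m = (\<Sum>i<k. E j i * b i m)" if "m < k" for j m
  proof -
    have "(\<Sum>i<k. E j i * b i m) = (\<Sum>i<k. \<Sum>l<k. b j l * (C' i l * b i m))"
      by (simp add: C sum_distrib_right mult.assoc)
    also have "\<dots> = (\<Sum>l<k. b j l * (\<Sum>i<k. C' i l * b i m))"
      by (subst sum.swap) (simp add: sum_distrib_left)
    also have "\<dots> = (\<Sum>l<k. if l = m then b j l else 0)"
      by (rule sum.cong) (use that in \<open>auto simp: inv\<close>)
    finally show ?thesis using that by simp
  qed
  from that[of "\<lambda>l i. C' i l", OF C this] show ?thesis .
qed

lemma in_image_proj: "in_image (proj y)"
proof -
  obtain C where C: "\<And>j i. i < k \<Longrightarrow> E j i = (\<Sum>l<k. b j l * C l i)"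
    and "\<And>j m. m < k \<Longrightarrow> b j m = (\<Sum>i<k. E j i * b i m)" by (rule E_factorization) (rule that)
  have "proj y j = (\<Sum>l<k. b j l * (\<Sum>i<k. C l i * y i))" for j
  proof -
    have "proj y j = (\<Sum>i<k. \<Sum>l<k. b j l * (C l i * y i))"
      by (simp add: proj_def C sum_distrib_right mult.assoc)
    also have "\<dots> = (\<Sum>l<k. b j l * (\<Sum>i<k. C l i * y i))"
      by (subst sum.swap) (simp add: sum_distrib_left)
    finally show ?thesis .
  qed
  then show ?thesis unfolding in_image_def by (intro exI[of _ "\<lambda>l. \<Sum>i<k. C l i * y i"]) simp
qed

lemma in_image_cong: "(\<And>j. j < n \<Longrightarrow> y j = y' j) \<Longrightarrow> in_image y \<longleftrightarrow> in_image y'"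
  by (auto simp: in_image_def)

lemma in_image_iff_proj: "in_image y \<longleftrightarrow> (\<forall>j<n. y j = proj y j)"
proof
  assume "in_image y"
  then obtain t where t: "\<And>j. j < n \<Longrightarrow> y j = (\<Sum>m<k. b j m * t m)" by (auto simp: in_image_def)
  obtain C where "\<And>j i. i < k \<Longrightarrow> E j i = (\<Sum>l<k. b j l * C l i)"
    and b: "\<And>j m. m < k \<Longrightarrow> b j m = (\<Sum>i<k. E j i * b i m)" by (rule E_factorization) (rule that)
  show "\<forall>j<n. y j = proj y j"
  proof (intro allI impI)
    fix j assume "j < n"
    have "proj y j = (\<Sum>i<k. \<Sum>m<k. E j i * b i m * t m)"
      unfolding proj_def using t k_less by (simp add: sum_distrib_left mult.assoc)
    also have "\<dots> = (\<Sum>m<k. (\<Sum>i<k. E j i * b i m) * t m)"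
      by (subst sum.swap) (simp add: sum_distrib_right)
    also have "\<dots> = (\<Sum>m<k. b j m * t m)" using b by simp
    finally show "y j = proj y j" using t[OF \<open>j < n\<close>] by simp
  qed
next
  assume "\<forall>j<n. y j = proj y j"
  then have "in_image y \<longleftrightarrow> in_image (proj y)" by (intro in_image_cong) auto
  with in_image_proj show "in_image y" by simp
qed

lemma annihilates_iff_dual: "annihilates p \<longleftrightarrow> (\<forall>i<k. dual p i = 0)"
proof -
  obtain C where C: "\<And>j i. i < k \<Longrightarrow> E j i = (\<Sum>l<k. b j l * C l i)"
    and b: "\<And>j m. m < k \<Longrightarrow> b j m = (\<Sum>i<k. E j i * b i m)" by (rule E_factorization) (rule that)
  have 1: "(\<Sum>j<n. b j m * p j) = (\<Sum>i<k. dual p i * b i m)" if "m < k" for m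
  proof -
    have "(\<Sum>j<n. b j m * p j) = (\<Sum>j<n. \<Sum>i<k. E j i * p j * b i m)"
      by (subst b[OF that]) (simp add: sum_distrib_left sum_distrib_right mult_ac)
    also have "\<dots> = (\<Sum>i<k. dual p i * b i m)"
      unfolding dual_def by (subst sum.swap) (simp add: sum_distrib_right)
    finally show ?thesis .
  qed
  have 2: "dual p i = (\<Sum>l<k. (\<Sum>j<n. b j l * p j) * C l i)" if "i < k" for i
  proof -
    have "dual p i = (\<Sum>j<n. \<Sum>l<k. b j l * p j * C l i)"
      using that by (simp add: dual_def C sum_distrib_left mult_ac)
    also have "\<dots> = (\<Sum>l<k. (\<Sum>j<n. b j l * p j) * C l i)"
      by (subst sum.swap) (simp add: sum_distrib_right)
    finally show ?thesis .
  qed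
  show ?thesis
  proof
    assume "annihilates p"
    then show "\<forall>i<k. dual p i = 0" by (simp add: 2 annihilates_def)
  next
    assume "\<forall>i<k. dual p i = 0"
    then show "annihilates p" by (simp add: 1 annihilates_def)
  qed
qed

lemma pairing_zero:
  assumes "annihilates p" "in_image y"
  shows "(\<Sum>j<n. p j * y j) = 0"
proof -
  obtain t where t: "\<And>j. j < n \<Longrightarrow> y j = (\<Sum>m<k. b j m * t m)"
    using assms(2) by (auto simp: in_image_def)
  have "(\<Sum>j<n. p j * y j) = (\<Sum>j<n. \<Sum>m<k. b j m * p j * t m)"
    by (simp add: t sum_distrib_left mult_ac)
  also have "\<dots> = (\<Sum>m<k. (\<Sum>j<n. b j m * p j) * t m)"
    by (subst sum.swap) (simp add: sum_distrib_right)
  also have "\<dots> = 0" using assms(1) by (simp add: annihilates_def)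
  finally show ?thesis .
qed

lemma proj_below: "j < k \<Longrightarrow> proj y j = y j"
  by (simp add: proj_def E_delta if_distrib[of "\<lambda>c. c * _"] cong: if_cong)

lemma circuit_form_image:
  assumes "in_image y" "length is = Suc k" "set is \<subseteq> {..<n}"
  shows "circuit_form b is y = 0"
proof -
  obtain t where t: "\<And>j. j < n \<Longrightarrow> y j = (\<Sum>m<k. b j m * t m)"
    using assms(1) by (auto simp: in_image_def)
  have "circuit_form b is y = circuit_form b is (\<lambda>j. \<Sum>m<k. b j m * t m)"
    by (rule circuit_form_cong) (use assms(3) t in auto)
  also have "\<dots> = 0"
    unfolding circuit_form_sum circuit_form_cmult by (simp add: circuit_form_column[OF assms(2)])
  finally show ?thesis .
qed

text \<open>The circuit through \<open>0, \<dots>, k - 1, j\<close> kills the image and does not see the coordinates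
  below \<open>k\<close> of \<open>y - proj y\<close>, since these vanish.\<close>

lemma circuit_form_base:
  assumes "k \<le> j" "j < n"
  shows "circuit_form b ([0..<k] @ [j]) y = (-1) ^ k * minor b [0..<k] * (y j - proj y j)"
proof -
  let ?is = "[0..<k] @ [j]"
  have "circuit_form b ?is (proj y) = 0"
    by (rule circuit_form_image[OF in_image_proj]) (use assms k_less in auto)
  then have "circuit_form b ?is y = circuit_form b ?is (\<lambda>j. y j - proj y j)"
    by (simp add: circuit_form_diff)
  also have "\<dots> = (-1) ^ k * minor b (omit_nth k ?is) * (y j - proj y j)"
    by (simp add: circuit_form_def nth_append proj_below)
  also have "omit_nth k ?is = [0..<k]" by (simp add: omit_nth_def)
  finally show ?thesis .
qed

lemma base_in_index_lists: "i < k \<Longrightarrow> omit_nth i [0..<k] \<in> index_lists n (k - 1)"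
  using k_less set_omit_nth[of i "[0..<k]"]
  by (auto simp: index_lists_def length_omit_nth omit_nth_def sorted_wrt_append take_upt drop_upt)

lemma base_circuit_in_index_lists: "k \<le> j \<Longrightarrow> j < n \<Longrightarrow> [0..<k] @ [j] \<in> index_lists n (k + 1)"
  using k_less by (auto simp: index_lists_def sorted_wrt_append)

lemma index_listsD:
  assumes "is \<in> index_lists n r"
  shows "length is = r" "set is \<subseteq> {..<n}" "distinct is"
  using assms strict_sorted_iff[of "is"] by (auto simp: index_lists_def)

lemma annihilates_circuit_vector:
  assumes "length is = Suc k" "set is \<subseteq> {..<n}"
  shows "annihilates (circuit_vector b is)"
  unfolding annihilates_def using circuit_form_column[OF assms(1)]
  by (simp add: sum_circuit_vector[OF assms(2)])

lemma circuit_vector_nonzero: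
  assumes "length is = Suc k" "set is \<subseteq> {..<n}" "distinct is" "j \<in> set is"
  shows "circuit_vector b is j \<noteq> 0"
proof -
  obtain m where m: "m < length is" "is ! m = j" using assms(4) by (auto simp: in_set_conv_nth)
  have "minor b (omit_nth m is) \<noteq> 0"
    by (rule minor_nonzero)
      (use assms m set_omit_nth[of m "is"] distinct_omit_nth in \<open>auto simp: length_omit_nth\<close>)
  with circuit_vector_nth[OF assms(3) m(1), of b] m(2) show ?thesis by simp
qed

end

section \<open>Branches of the logarithm\<close>

text \<open>The principal branch, rotated so that its cut avoids \<open>w\<close>.\<close>

lemma log_branch_exists:
  assumes "w \<noteq> 0"
  shows "\<exists>L. log_branch_at L w"
proof -
  let ?S = "(\<lambda>u. u / w) -` (- \<real>\<^sub>\<le>\<^sub>0)"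
  have "open ?S" using assms by (intro open_vimage continuous_intros) (auto simp: open_Compl)
  moreover have "w \<in> ?S" using assms by simp
  moreover have "(\<lambda>u. Ln (u / w) + Ln w) holomorphic_on ?S"
    using assms by (auto intro!: holomorphic_intros)
  moreover have "exp (Ln (u / w) + Ln w) = u" if "u \<in> ?S" for u
  proof -
    have "u / w \<noteq> 0" using that by auto
    then show ?thesis using assms by (simp add: exp_add)
  qed
  ultimately show ?thesis unfolding log_branch_at_def by blast
qed

lemma log_branch_derivative:
  assumes "log_branch_at L w"
  shows "(L has_field_derivative 1 / w) (at w)"
proof -
  obtain S where S: "open S" "w \<in> S" "L holomorphic_on S" "\<And>u. u \<in> S \<Longrightarrow> exp (L u) = u"
    using assms unfolding log_branch_at_def by blast
  have L: "(L has_field_derivative deriv L w) (at w)"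
    using holomorphic_derivI[OF S(3,1,2)] .
  have "((\<lambda>u. exp (L u)) has_field_derivative exp (L w) * deriv L w) (at w)"
    using DERIV_chain2[OF DERIV_exp L] .
  moreover have "eventually (\<lambda>u. exp (L u) = u) (nhds w)"
    using S(1,2,4) by (auto simp: eventually_nhds)
  ultimately have "((\<lambda>u. u) has_field_derivative w * deriv L w) (at w)"
    using S(2,4) by (subst (asm) DERIV_cong_ev[OF refl _ refl]) auto
  then have "w * deriv L w = 1" using DERIV_ident DERIV_unique by blast
  then have "deriv L w = 1 / w" by (metis mult_zero_left nonzero_eq_divide_eq zero_neq_one mult.commute)
  with L show ?thesis by simp
qed

lemma finite_index_lists: "finite (index_lists n r)"
  by (rule finite_subset[OF _ finite_lists_length_eq[of "{..<n}" r]]) (auto simp: index_lists_def)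

lemma zariski_open_in_self: "zariski_open_in n X X"
  unfolding zariski_open_in_def zariski_closed_in_def
  by (auto intro!: exI[of _ "{\<lambda>_. 1}"] poly_fun.const)

context generic_arrangement
begin

declare split_paired_All [simp del] split_paired_Ex [simp del]

abbreviation X where "X \<equiv> ambient n k b"

section \<open>The variety as a graph\<close>

definition coord_prod :: "phase_point \<Rightarrow> complex" where
  "coord_prod x = (\<Prod>j<n. snd x $ j)"

text \<open>The ambient space is the complement of the zeros of this polynomial.\<close>

definition boundary :: "phase_point \<Rightarrow> complex" where
  "boundary x = coord_prod x * (\<Prod>is\<in>index_lists n (k + 1). f_circuit b is (fst x))"

text \<open>On the variety this is \<open>- g\<^sub>j(t)\<close>.\<close>

definition shift :: "phase_point \<Rightarrow> nat \<Rightarrow> complex" where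
  "shift x j = fst x $ j - a j / snd x $ j"

text \<open>The value of \<open>z\<close> is changed so that \<open>z - a/p\<close> is replaced by its projection onto the image;
  the points of the variety are fixed.\<close>

definition lift :: "phase_point \<Rightarrow> phase_point" where
  "lift x = (vec n (\<lambda>j. a j / snd x $ j + proj (shift x) j), snd x)"

text \<open>The affine space over which the variety is parametrised by \<open>lift\<close>.\<close>

definition conormal_points :: "phase_point set" where
  "conormal_points = {x \<in> phase_space n. annihilates (\<lambda>j. snd x $ j)}"

lemma coord_prod_nonzero_iff: "coord_prod x \<noteq> 0 \<longleftrightarrow> (\<forall>j<n. snd x $ j \<noteq> 0)"
  by (auto simp: coord_prod_def)

lemma ambient_eq: "X = {x \<in> phase_space n. boundary x \<noteq> 0}"
  by (auto simp: ambient_def phase_space_def boundary_def coord_prod_def discriminant_def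
      finite_index_lists)

lemma poly_fun_coord_prod: "coord_prod \<in> poly_fun n"
  unfolding coord_prod_def by (intro poly_fun_prod poly_fun_snd) auto

lemma nth_index_less: "set is \<subseteq> {..<n} \<Longrightarrow> l < length is \<Longrightarrow> is ! l < n"
  by (meson lessThan_iff nth_mem subsetD)

lemma poly_fun_f_circuit: "set is \<subseteq> {..<n} \<Longrightarrow> (\<lambda>x. f_circuit b is (fst x)) \<in> poly_fun n"
  unfolding f_circuit_def by (intro poly_fun_intros) (auto intro: nth_index_less)

lemma poly_fun_boundary: "boundary \<in> poly_fun n"
  unfolding boundary_def
  by (intro poly_fun.mult poly_fun_prod poly_fun_coord_prod poly_fun_f_circuit index_listsD)

lemma poly_fun_F_circuit: "set is \<subseteq> {..<n} \<Longrightarrow> F_circuit a b is \<in> poly_fun n"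
  unfolding F_circuit_def case_prod_unfold
  by (intro poly_fun.add poly_fun.mult poly_fun.const poly_fun_sum poly_fun_prod poly_fun_snd
      poly_fun_f_circuit) (auto intro: nth_index_less)

lemma poly_fun_F_linear: "F_linear n b is \<in> poly_fun n"
  unfolding F_linear_def case_prod_unfold by (intro poly_fun_intros) auto

text \<open>The second sum in \<open>F_circuit\<close> is minus the circuit form of \<open>a/p\<close> with its denominators cleared. Hence on the
  ambient space the circuit generators say that \<open>z - a/p\<close> lies in the image of the arrangement.\<close>

lemma F_circuit_eq:
  assumes "\<And>j. j \<in> set is \<Longrightarrow> snd x $ j \<noteq> 0"
  shows "F_circuit a b is x = (\<Prod>l<length is. snd x $ (is ! l)) * circuit_form b is (shift x)"
proof -
  let ?P = "\<Prod>l<length is. snd x $ (is ! l)"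
  have "?P * circuit_form b is (\<lambda>j. a j / snd x $ j) =
    (\<Sum>m<length is. (-1) ^ m * a (is ! m) * minor b (omit_nth m is) *
      (\<Prod>l\<in>{..<length is} - {m}. snd x $ (is ! l)))"
    unfolding circuit_form_def sum_distrib_left
  proof (rule sum.cong[OF refl])
    fix m assume m: "m \<in> {..<length is}"
    then have "?P = snd x $ (is ! m) * (\<Prod>l\<in>{..<length is} - {m}. snd x $ (is ! l))"
      by (intro prod.remove) auto
    moreover have "snd x $ (is ! m) \<noteq> 0" using assms m by simp
    ultimately show "?P * ((-1) ^ m * minor b (omit_nth m is) * (a (is ! m) / snd x $ (is ! m))) =
      (-1) ^ m * a (is ! m) * minor b (omit_nth m is) *
      (\<Prod>l\<in>{..<length is} - {m}. snd x $ (is ! l))" by simp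
  qed
  moreover have "circuit_form b is (shift x) =
      f_circuit b is (fst x) - circuit_form b is (\<lambda>j. a j / snd x $ j)"
    unfolding f_circuit_eq circuit_form_diff[symmetric] by (simp add: shift_def[abs_def])
  ultimately show ?thesis
    by (simp add: F_circuit_def case_prod_unfold right_diff_distrib sum_negf)
qed

lemma f_fun_along_axis:
  assumes "t \<in> carrier_vec k" "i < k"
  shows "f_fun k b j z (t + s \<cdot>\<^sub>v unit_vec k i) = f_fun k b j z t + s * b j i"
proof -
  have "(\<Sum>m<k. b j m * (t + s \<cdot>\<^sub>v unit_vec k i) $ m) = (\<Sum>m<k. b j m * t $ m + (if m = i then s * b j m else 0))"
    by (rule sum.cong) (use assms in \<open>auto simp: unit_vec_def algebra_simps\<close>)
  then show ?thesis using assms(2) by (simp add: f_fun_def sum.distrib)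
qed

lemma critical_set_iff:
  assumes "(z, t) \<in> U0 n k b"
  shows "(z, t) \<in> critical_set n k a b \<longleftrightarrow> annihilates (\<lambda>j. a j / f_fun k b j z t)"
proof -
  have t: "t \<in> carrier_vec k" and nz: "\<And>j. j < n \<Longrightarrow> f_fun k b j z t \<noteq> 0"
    using assms by (auto simp: U0_def)
  have deriv: "((\<lambda>s. master_branch n k a b L z (t + s \<cdot>\<^sub>v unit_vec k i)) has_field_derivative
      (\<Sum>j<n. b j i * (a j / f_fun k b j z t))) (at 0)"
    if L: "\<forall>j<n. log_branch_at (L j) (f_fun k b j z t)" and i: "i < k" for L i
    unfolding master_branch_def f_fun_along_axis[OF t i]
  proof (rule DERIV_sum)
    fix j assume "j \<in> {..<n}"
    then have "(L j has_field_derivative 1 / f_fun k b j z t) (at (f_fun k b j z t + 0 * b j i))"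
      using log_branch_derivative L by simp
    moreover have "((\<lambda>s. f_fun k b j z t + s * b j i) has_field_derivative b j i) (at 0)"
      by (auto intro!: derivative_eq_intros)
    ultimately have "((\<lambda>s. L j (f_fun k b j z t + s * b j i)) has_field_derivative
        1 / f_fun k b j z t * b j i) (at 0)"
      by (rule DERIV_chain2)
    from DERIV_cmult[OF this, of "a j"]
    show "((\<lambda>s. a j * L j (f_fun k b j z t + s * b j i)) has_field_derivative
        b j i * (a j / f_fun k b j z t)) (at 0)" by (simp add: mult_ac)
  qed
  have "\<forall>j\<in>{..<n}. \<exists>L. log_branch_at L (f_fun k b j z t)"
    using log_branch_exists nz by simp
  from bchoice[OF this] obtain L where L: "\<forall>j<n. log_branch_at (L j) (f_fun k b j z t)" by auto
  show ?thesis
  proof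
    assume "(z, t) \<in> critical_set n k a b"
    then obtain L where "\<forall>j<n. log_branch_at (L j) (f_fun k b j z t)"
      "\<And>i. i < k \<Longrightarrow> ((\<lambda>s. master_branch n k a b L z (t + s \<cdot>\<^sub>v unit_vec k i))
        has_field_derivative 0) (at 0)"
      by (auto simp: critical_set_def)
    then show "annihilates (\<lambda>j. a j / f_fun k b j z t)"
      unfolding annihilates_def using deriv DERIV_unique by blast
  next
    assume "annihilates (\<lambda>j. a j / f_fun k b j z t)"
    then have "((\<lambda>s. master_branch n k a b L z (t + s \<cdot>\<^sub>v unit_vec k i))
        has_field_derivative 0) (at 0)" if "i < k" for i
      using deriv[OF L that] that by (simp add: annihilates_def)
    with L assms show "(z, t) \<in> critical_set n k a b" by (auto simp: critical_set_def)
  qed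
qed

text \<open>Here \<open>t\<close> is eliminated: \<open>p\<close> determines the values \<open>f\<^sub>j = a\<^sub>j / p\<^sub>j\<close>, and they are attained at some \<open>t\<close>
  exactly if \<open>z - a/p\<close> lies in the image.\<close>

lemma Lambda_eq: "Lambda n k a b = {x \<in> X. annihilates (\<lambda>j. snd x $ j) \<and> in_image (shift x)}"
proof (intro equalityI subsetI)
  fix x assume "x \<in> Lambda n k a b"
  then obtain z t where zt: "(z, t) \<in> critical_set n k a b" "x = phi_map n k a b (z, t)"
    by (auto simp: Lambda_def)
  then have U: "(z, t) \<in> U0 n k b" by (auto simp: critical_set_def)
  have x: "fst x = z" "snd x = vec n (\<lambda>j. a j / f_fun k b j z t)"
    using zt(2) by (auto simp: phi_map_def)
  have "annihilates (\<lambda>j. a j / f_fun k b j z t)" using critical_set_iff[OF U] zt(1) by simp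
  then have "annihilates (\<lambda>j. snd x $ j)" by (simp add: annihilates_def x)
  moreover have "x \<in> X"
    using zt(2) U a_nonzero by (auto simp: phi_map_def ambient_def U0_def)
  moreover have "in_image (shift x)"
    unfolding in_image_def
    by (rule exI[of _ "\<lambda>m. - t $ m"])
      (use U a_nonzero in \<open>auto simp: shift_def x f_fun_def U0_def sum_negf\<close>)
  ultimately show "x \<in> {x \<in> X. annihilates (\<lambda>j. snd x $ j) \<and> in_image (shift x)}" by simp
next
  fix x assume x: "x \<in> {x \<in> X. annihilates (\<lambda>j. snd x $ j) \<and> in_image (shift x)}"
  then obtain t' where t': "\<And>j. j < n \<Longrightarrow> shift x j = (\<Sum>m<k. b j m * t' m)"
    by (auto simp: in_image_def)
  have p: "snd x \<in> carrier_vec n" "\<And>j. j < n \<Longrightarrow> snd x $ j \<noteq> 0"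
    and z: "fst x \<in> carrier_vec n" "fst x \<notin> discriminant n k b"
    using x by (auto simp: ambient_def)
  define t where "t = vec k (\<lambda>m. - t' m)"
  have f: "f_fun k b j (fst x) t = a j / snd x $ j" if "j < n" for j
    using t'[OF that] by (simp add: f_fun_def t_def shift_def sum_negf algebra_simps)
  have U: "(fst x, t) \<in> U0 n k b"
    using z f p(2) a_nonzero by (auto simp: U0_def t_def)
  have "annihilates (\<lambda>j. a j / f_fun k b j (fst x) t)"
    using x f p(2) a_nonzero by (simp add: annihilates_def)
  then have "(fst x, t) \<in> critical_set n k a b" using critical_set_iff[OF U] by simp
  moreover have "phi_map n k a b (fst x, t) = x"
    using f p a_nonzero by (cases x) (auto simp: phi_map_def)
  ultimately show "x \<in> Lambda n k a b" unfolding Lambda_def by (metis image_eqI)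
qed

lemma Lambda_subset: "Lambda n k a b \<subseteq> X"
  by (auto simp: Lambda_eq)

lemma shift_lift: "j < n \<Longrightarrow> shift (lift x) j = proj (shift x) j"
  by (simp add: shift_def lift_def)

lemma lift_in_Lambda:
  assumes "x \<in> conormal_points" "boundary (lift x) \<noteq> 0"
  shows "lift x \<in> Lambda n k a b"
proof -
  have "in_image (shift (lift x)) \<longleftrightarrow> in_image (proj (shift x))"
    by (rule in_image_cong) (rule shift_lift)
  moreover have "lift x \<in> phase_space n"
    using assms(1) by (auto simp: conormal_points_def lift_def phase_space_def)
  ultimately show ?thesis
    using assms by (simp add: Lambda_eq ambient_eq in_image_proj conormal_points_def lift_def)
qed

lemma lift_Lambda:
  assumes "x \<in> Lambda n k a b"
  shows "lift x = x"
proof -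
  have "\<forall>j<n. shift x j = proj (shift x) j" and "fst x \<in> carrier_vec n"
    using assms by (auto simp: Lambda_eq in_image_iff_proj ambient_def)
  then show ?thesis
    by (intro prod_eqI) (auto simp: lift_def shift_def algebra_simps intro!: eq_vecI)
qed

text \<open>The coordinates of \<open>lift x\<close> have only the \<open>p\<^sub>j\<close> as denominators.\<close>

lemma poly_fun_lift_numerator:
  assumes "F \<in> poly_fun n"
  shows "\<exists>P\<in>poly_fun n. \<exists>N. \<forall>x. coord_prod x \<noteq> 0 \<longrightarrow> P x = coord_prod x ^ N * F (lift x)"
  using assms
proof induction
  case (const c)
  show ?case by (intro bexI[of _ "\<lambda>_. c"] exI[of _ 0]) (simp_all add: poly_fun.const)
next
  case (coord_z j)
  define Q where "Q i x = a i * (\<Prod>l\<in>{..<n} - {i}. snd x $ l)" for i and x :: phase_point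
  have Q: "Q i x = coord_prod x * (a i / snd x $ i)" if "i < n" "coord_prod x \<noteq> 0" for i x
  proof -
    have "coord_prod x = snd x $ i * (\<Prod>l\<in>{..<n} - {i}. snd x $ l)"
      unfolding coord_prod_def using that(1) by (intro prod.remove) auto
    moreover have "snd x $ i \<noteq> 0" using that coord_prod_nonzero_iff by blast
    ultimately show ?thesis by (simp add: Q_def)
  qed
  have Q_poly: "Q i \<in> poly_fun n" for i
    unfolding Q_def by (intro poly_fun_cmult poly_fun_prod poly_fun_snd) auto
  show ?case
  proof (intro bexI[of _ "\<lambda>x. Q j x + (\<Sum>i<k. E j i * (fst x $ i * coord_prod x - Q i x))"]
      exI[of _ 1] allI impI)
    show "(\<lambda>x. Q j x + (\<Sum>i<k. E j i * (fst x $ i * coord_prod x - Q i x))) \<in> poly_fun n"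
      using k_less by (intro poly_fun.add poly_fun_sum poly_fun_cmult poly_fun_diff poly_fun.mult
        poly_fun_fst poly_fun_coord_prod Q_poly) auto
    fix x assume x: "coord_prod x \<noteq> 0"
    have "coord_prod x * proj (shift x) j = (\<Sum>i<k. E j i * (fst x $ i * coord_prod x - Q i x))"
      unfolding proj_def sum_distrib_left
      by (rule sum.cong) (use k_less x in \<open>auto simp: Q shift_def algebra_simps\<close>)
    then show "Q j x + (\<Sum>i<k. E j i * (fst x $ i * coord_prod x - Q i x)) =
        coord_prod x ^ 1 * (case lift x of (z, p) \<Rightarrow> z $ j)"
      using coord_z x by (simp add: lift_def Q distrib_left)
  qed
next
  case (coord_p j)
  then show ?case
    by (intro bexI[of _ "\<lambda>x. snd x $ j"] exI[of _ 0]) (simp_all add: lift_def poly_fun_snd)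
next
  case (add F G)
  then obtain P N Q M where P: "P \<in> poly_fun n" "Q \<in> poly_fun n"
    "\<forall>x. coord_prod x \<noteq> 0 \<longrightarrow> P x = coord_prod x ^ N * F (lift x)"
    "\<forall>x. coord_prod x \<noteq> 0 \<longrightarrow> Q x = coord_prod x ^ M * G (lift x)" by blast
  have "(\<lambda>x. coord_prod x ^ M * P x + coord_prod x ^ N * Q x) \<in> poly_fun n"
    using P(1,2) by (intro poly_fun.add poly_fun.mult poly_fun_power poly_fun_coord_prod)
  then show ?case
    by (intro bexI[of _ "\<lambda>x. coord_prod x ^ M * P x + coord_prod x ^ N * Q x"] exI[of _ "N + M"])
      (use P(3,4) in \<open>simp_all add: power_add algebra_simps\<close>)
next
  case (mult F G)
  then obtain P N Q M where P: "P \<in> poly_fun n" "Q \<in> poly_fun n"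
    "\<forall>x. coord_prod x \<noteq> 0 \<longrightarrow> P x = coord_prod x ^ N * F (lift x)"
    "\<forall>x. coord_prod x \<noteq> 0 \<longrightarrow> Q x = coord_prod x ^ M * G (lift x)" by blast
  show ?case
    by (intro bexI[of _ "\<lambda>x. P x * Q x"] exI[of _ "N + M"])
      (use P in \<open>auto simp: power_add intro: poly_fun.mult\<close>)
qed

lemma boundary_imp_coord_prod: "boundary x \<noteq> 0 \<Longrightarrow> coord_prod x \<noteq> 0"
  by (auto simp: boundary_def)

lemma conormal_points_line:
  assumes "x \<in> conormal_points" "y \<in> conormal_points"
  shows "line_point n x y s \<in> conormal_points"
proof -
  have "(\<Sum>j<n. b j m * (snd x $ j + s * (snd y $ j - snd x $ j))) = 0" if "m < k" for m
  proof -
    have "(\<Sum>j<n. b j m * (snd x $ j + s * (snd y $ j - snd x $ j))) =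
      (1 - s) * (\<Sum>j<n. b j m * snd x $ j) + s * (\<Sum>j<n. b j m * snd y $ j)"
      by (simp add: sum_distrib_left sum.distrib[symmetric] algebra_simps)
    then show ?thesis using assms that by (simp add: conormal_points_def annihilates_def)
  qed
  then show ?thesis
    by (simp add: conormal_points_def annihilates_def line_point_def phase_space_def)
qed

section \<open>The variety is nonempty and irreducible\<close>

lemma circuit_point:
  assumes "length is = Suc k" "set is \<subseteq> {..<n}" "distinct is"
  shows "(0\<^sub>v n, vec n (circuit_vector b is)) \<in> conormal_points"
  using annihilates_circuit_vector[OF assms(1,2)]
  by (simp add: conormal_points_def phase_space_def annihilates_def)

lemma circuit_through_avoiding:
  assumes "j < n" "j \<notin> A" "A \<subseteq> {..<n}" "card A + k < n"
  obtains "is" where "length is = Suc k" "set is \<subseteq> {..<n}" "distinct is" "j \<in> set is" "set is \<inter> A = {}"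
proof -
  have "finite A" using assms(3) finite_subset by blast
  then have "k \<le> card ({..<n} - insert j A)" using assms by (simp add: card_Diff_subset)
  then obtain T where T: "T \<subseteq> {..<n} - insert j A" "card T = k" "finite T"
    by (meson finite_Diff finite_lessThan obtain_subset_with_card_n)
  then have "j \<notin> T" by blast
  show ?thesis
    by (rule that[of "j # sorted_list_of_set T"]) (use T assms \<open>j \<notin> T\<close> in auto)
qed

definition zero_section_points :: "phase_point set" where
  "zero_section_points = {x \<in> conormal_points. fst x = 0\<^sub>v n}"

lemma zero_section_points_line:
  assumes "x \<in> zero_section_points" "y \<in> zero_section_points"
  shows "line_point n x y s \<in> zero_section_points"
  using conormal_points_line[of x y s] assms
  by (auto simp: zero_section_points_def line_point_def)

text \<open>If \<open>n = k + 1\<close>, the annihilator is spanned by the circuit vector \<open>p\<close> and \<open>F_circuit\<close> takes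
  at \<open>(0, p)\<close> the value \<open>- |a| p\<^sub>1 \<cdots> p\<^sub>n\<close>. If \<open>n > k + 1\<close>, one coordinate \<open>p\<^sub>i\<close> of the circuit may be
  made zero, keeping the others nonzero; then one single term of \<open>F_circuit\<close> survives.\<close>

lemma F_circuit_nonzero_somewhere:
  assumes "is \<in> index_lists n (k + 1)"
  shows "\<exists>x\<in>zero_section_points. F_circuit a b is x \<noteq> 0"
proof -
  note index = index_listsD[OF assms, simplified]
  have at_zero: "F_circuit a b is x = - (\<Sum>m<length is. (-1) ^ m * a (is ! m) * minor b (omit_nth m is) *
        (\<Prod>l\<in>{..<length is} - {m}. snd x $ (is ! l)))" if "fst x = 0\<^sub>v n" for x
  proof -
    have "f_circuit b is (fst x) = 0"
      unfolding f_circuit_def using that nth_index_less[OF index(2)] by (intro sum.neutral) auto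
    then show ?thesis by (simp add: F_circuit_def case_prod_unfold sum_negf)
  qed
  show ?thesis
  proof (cases "n = Suc k")
    case True
    let ?q = "circuit_vector b is"
    let ?x = "(0\<^sub>v n, vec n ?q) :: phase_point"
    have set_is: "set is = {..<n}"
      using index True by (intro card_subset_eq) (auto simp: distinct_card)
    have bij: "bij_betw (\<lambda>m. is ! m) {..<length is} {..<n}"
      using bij_betw_nth[OF index(3) refl set_is[symmetric]] by simp
    have "F_circuit a b is ?x = - (\<Sum>m<length is. a (is ! m) * (\<Prod>j<n. ?q j))"
    proof (subst at_zero)
      have "(-1) ^ m * a (is ! m) * minor b (omit_nth m is) *
          (\<Prod>l\<in>{..<length is} - {m}. snd ?x $ (is ! l)) = a (is ! m) * (\<Prod>j<n. ?q j)"
        if m: "m < length is" for m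
      proof -
        have "(\<Prod>j<n. ?q j) = (\<Prod>l<length is. ?q (is ! l))"
          using prod.reindex_bij_betw[OF bij, of ?q] by simp
        also have "\<dots> = ?q (is ! m) * (\<Prod>l\<in>{..<length is} - {m}. ?q (is ! l))"
          by (rule prod.remove) (use m in auto)
        also have "?q (is ! m) = (-1) ^ m * minor b (omit_nth m is)"
          by (rule circuit_vector_nth) (use index m in auto)
        also have "(\<Prod>l\<in>{..<length is} - {m}. ?q (is ! l)) =
            (\<Prod>l\<in>{..<length is} - {m}. snd ?x $ (is ! l))"
          by (rule prod.cong) (use nth_index_less[OF index(2)] in auto)
        finally show ?thesis by (simp add: mult_ac)
      qed
      then show "- (\<Sum>m<length is. (-1) ^ m * a (is ! m) * minor b (omit_nth m is) *
          (\<Prod>l\<in>{..<length is} - {m}. snd ?x $ (is ! l))) =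
          - (\<Sum>m<length is. a (is ! m) * (\<Prod>j<n. ?q j))"
        by (intro arg_cong[of _ _ uminus] sum.cong) auto
    qed simp
    also have "\<dots> = - (\<Sum>j<n. a j) * (\<Prod>j<n. ?q j)"
      using sum.reindex_bij_betw[OF bij, of a] by (simp add: sum_distrib_right[symmetric])
    finally have "F_circuit a b is ?x = - (\<Sum>j<n. a j) * (\<Prod>j<n. ?q j)" .
    moreover have "?q j \<noteq> 0" if "j < n" for j
      by (rule circuit_vector_nonzero) (use index set_is that in auto)
    ultimately have "F_circuit a b is ?x \<noteq> 0" using sum_a by simp
    moreover have "?x \<in> zero_section_points"
      using circuit_point[of "is"] index by (simp add: zero_section_points_def)
    ultimately show ?thesis by blast
  next
    case False
    let ?i = "is ! 0"
    let ?S = "{x \<in> zero_section_points. snd x $ ?i = 0}"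
    have i: "?i < n" using index by (metis length_greater_0_conv lessThan_iff nth_mem subsetD zero_less_Suc)
    have "\<exists>x\<in>?S. \<forall>F\<in>(\<lambda>j x. snd x $ j) ` ({..<n} - {?i}). F x \<noteq> 0"
    proof (rule common_nonzero_point)
      show "(\<lambda>j (x::phase_point). snd x $ j) ` ({..<n} - {?i}) \<subseteq> poly_fun n"
        by (auto intro: poly_fun_snd)
      show "?S \<subseteq> phase_space n" by (auto simp: zero_section_points_def conormal_points_def)
      have "(0\<^sub>v n, 0\<^sub>v n) \<in> ?S"
        using i by (simp add: zero_section_points_def conormal_points_def phase_space_def annihilates_def)
      then show "?S \<noteq> {}" by blast
      show "line_point n x y s \<in> ?S" if "x \<in> ?S" "y \<in> ?S" for x y s
        using zero_section_points_line[of x y s] that i by (simp add: line_point_def)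
    next
      fix F :: "phase_point \<Rightarrow> complex" assume "F \<in> (\<lambda>j x. snd x $ j) ` ({..<n} - {?i})"
      then obtain j where j: "F = (\<lambda>x. snd x $ j)" "j < n" "?i \<noteq> j" by auto
      have "Suc k < n" using False k_less by simp
      then obtain js where
        js: "length js = Suc k" "set js \<subseteq> {..<n}" "distinct js" "j \<in> set js" "set js \<inter> {?i} = {}"
        using circuit_through_avoiding[of j "{?i}"] i j by auto
      show "\<exists>x\<in>?S. F x \<noteq> 0"
        by (rule bexI[of _ "(0\<^sub>v n, vec n (circuit_vector b js))"])
          (use j i js circuit_point[of js] circuit_vector_nonzero[of js j] circuit_vector_outside
            in \<open>auto simp: zero_section_points_def\<close>)
    qed auto
    then obtain x where x: "x \<in> zero_section_points" "snd x $ ?i = 0"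
      "\<And>j. j < n \<Longrightarrow> j \<noteq> ?i \<Longrightarrow> snd x $ j \<noteq> 0" by auto
    have idx: "is ! l < n" if "l < length is" for l using index(2) that nth_mem by fastforce
    have len: "0 < length is" using index(1) by simp
    have "F_circuit a b is x = - (a ?i * minor b (omit_nth 0 is) *
        (\<Prod>l\<in>{..<length is} - {0}. snd x $ (is ! l)))"
    proof -
      have "(\<Prod>l\<in>{..<length is} - {m}. snd x $ (is ! l)) = 0" if "m \<in> {..<length is} - {0}" for m
        using that x(2) len by (intro prod_zero) auto
      then have "(\<Sum>m\<in>{..<length is} - {0}. (-1) ^ m * a (is ! m) * minor b (omit_nth m is) *
          (\<Prod>l\<in>{..<length is} - {m}. snd x $ (is ! l))) = 0"
        by (intro sum.neutral) auto
      moreover have "fst x = 0\<^sub>v n" using x(1) by (simp add: zero_section_points_def)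
      ultimately show ?thesis
        using len by (simp add: at_zero sum.remove[of "{..<length is}" 0])
    qed
    moreover have "snd x $ (is ! l) \<noteq> 0" if "l \<in> {..<length is} - {0}" for l
      using x(3)[of "is ! l"] idx[of l] that index(3) len by (auto simp: nth_eq_iff_index_eq)
    moreover have "minor b (omit_nth 0 is) \<noteq> 0"
      by (rule minor_nonzero)
        (use index len set_omit_nth[of 0 "is"] distinct_omit_nth(1)[of "is" 0] in \<open>auto simp: length_omit_nth\<close>)
    ultimately have "F_circuit a b is x \<noteq> 0" using a_nonzero[OF i] by simp
    with x(1) show ?thesis by blast
  qed
qed

lemma Lambda_nonempty: "Lambda n k a b \<noteq> {}"
proof -
  let ?\<F> = "(\<lambda>j (x::phase_point). snd x $ j) ` {..<n} \<union> F_circuit a b ` index_lists n (k + 1)"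
  have "\<exists>x\<in>zero_section_points. \<forall>F\<in>?\<F>. F x \<noteq> 0"
  proof (rule common_nonzero_point)
    show "finite ?\<F>" by (simp add: finite_index_lists)
    show "?\<F> \<subseteq> poly_fun n" using index_listsD poly_fun_F_circuit by (auto intro!: poly_fun_snd)
    show "zero_section_points \<subseteq> phase_space n" by (auto simp: zero_section_points_def conormal_points_def)
    have "(0\<^sub>v n, 0\<^sub>v n) \<in> zero_section_points"
      by (simp add: zero_section_points_def conormal_points_def phase_space_def annihilates_def)
    then show "zero_section_points \<noteq> {}" by blast
  next
    fix F assume "F \<in> ?\<F>"
    then consider j where "j < n" "F = (\<lambda>x. snd x $ j)"
      | "is" where "is \<in> index_lists n (k + 1)" "F = F_circuit a b is" by auto
    then show "\<exists>x\<in>zero_section_points. F x \<noteq> 0"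
    proof cases
      case 1
      obtain js where
        js: "length js = Suc k" "set js \<subseteq> {..<n}" "distinct js" "j \<in> set js"
        using circuit_through_avoiding[of j "{}"] 1(1) k_less by auto
      show ?thesis
        by (rule bexI[of _ "(0\<^sub>v n, vec n (circuit_vector b js))"])
          (use 1 js circuit_point[of js] circuit_vector_nonzero[of js j]
            in \<open>auto simp: zero_section_points_def\<close>)
    next
      case 2
      then show ?thesis using F_circuit_nonzero_somewhere by simp
    qed
  qed (rule zero_section_points_line)
  then obtain x where "x \<in> zero_section_points" "\<forall>F\<in>?\<F>. F x \<noteq> 0" by blast
  then have x: "x \<in> zero_section_points" "\<And>j. j < n \<Longrightarrow> snd x $ j \<noteq> 0"
    "\<And>is. is \<in> index_lists n (k + 1) \<Longrightarrow> F_circuit a b is x \<noteq> 0" by auto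
  \<comment> \<open>The critical point with \<open>t = 0\<close>.\<close>
  define y where "y = (vec n (\<lambda>j. a j / snd x $ j), snd x)"
  have "in_image (shift y)"
    unfolding in_image_def by (rule exI[of _ "\<lambda>_. 0"]) (simp add: shift_def y_def)
  moreover have "f_circuit b is (fst y) \<noteq> 0" if "is \<in> index_lists n (k + 1)" for "is"
  proof -
    note index = index_listsD[OF that]
    have "circuit_form b is (shift x) = circuit_form b is (\<lambda>j. 0 - fst y $ j)"
      by (rule circuit_form_cong)
        (use x(1) index(2) in \<open>auto simp: shift_def y_def zero_section_points_def\<close>)
    also have "\<dots> = circuit_form b is (\<lambda>j. 0) - circuit_form b is (\<lambda>j. fst y $ j)"
      by (rule circuit_form_diff)
    also have "circuit_form b is (\<lambda>j. 0) = 0" by (simp add: circuit_form_def)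
    finally show ?thesis
      using x(3)[OF that] F_circuit_eq[of "is" x, OF x(2)[OF subsetD[OF index(2), simplified]]]
      by (auto simp: f_circuit_eq)
  qed
  ultimately have "y \<in> Lambda n k a b"
    using x(1,2) by (auto simp: Lambda_eq ambient_def discriminant_def zero_section_points_def
        conormal_points_def phase_space_def y_def)
  then show ?thesis by blast
qed

text \<open>The graph map sends a dense open subset of the affine space \<open>conormal_points\<close> to the
  variety; so finitely many functions, each nonzero somewhere on the variety, are simultaneously
  nonzero at some point of it.\<close>

lemma Lambda_common_nonzero:
  assumes "finite \<F>" "\<F> \<subseteq> poly_fun n" "\<And>F. F \<in> \<F> \<Longrightarrow> \<exists>x\<in>Lambda n k a b. F x \<noteq> 0"
  shows "\<exists>x\<in>Lambda n k a b. \<forall>F\<in>\<F>. F x \<noteq> 0"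
proof -
  have "\<forall>F\<in>poly_fun n. \<exists>P. P \<in> poly_fun n \<and>
      (\<exists>N. \<forall>x. coord_prod x \<noteq> 0 \<longrightarrow> P x = coord_prod x ^ N * F (lift x))"
    using poly_fun_lift_numerator by blast
  from bchoice[OF this] obtain num where num: "\<forall>F\<in>poly_fun n. num F \<in> poly_fun n \<and>
      (\<exists>N. \<forall>x. coord_prod x \<noteq> 0 \<longrightarrow> num F x = coord_prod x ^ N * F (lift x))" ..
  let ?\<G> = "insert coord_prod (num ` insert boundary \<F>)"
  have "\<exists>x\<in>conormal_points. \<forall>P\<in>?\<G>. P x \<noteq> 0"
  proof (rule common_nonzero_point)
    show "finite ?\<G>" using assms(1) by simp
    show "?\<G> \<subseteq> poly_fun n" using num assms(2) poly_fun_boundary poly_fun_coord_prod by auto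
    show "conormal_points \<subseteq> phase_space n" by (auto simp: conormal_points_def)
    have sub: "x \<in> conormal_points \<and> boundary x \<noteq> 0" if "x \<in> Lambda n k a b" for x
      using that by (auto simp: Lambda_eq conormal_points_def ambient_eq)
    then show "conormal_points \<noteq> {}" using Lambda_nonempty by blast
    fix P assume "P \<in> ?\<G>"
    then consider "P = coord_prod" | F where "F \<in> insert boundary \<F>" "P = num F" by auto
    then show "\<exists>x\<in>conormal_points. P x \<noteq> 0"
    proof cases
      case 1
      then show ?thesis using Lambda_nonempty sub boundary_imp_coord_prod by blast
    next
      case 2
      have "\<exists>x\<in>Lambda n k a b. F x \<noteq> 0"
      proof (cases "F = boundary")
        case True
        then show ?thesis using Lambda_nonempty sub by blast
      qed (use 2 assms(3) in auto)
      then obtain x where x: "x \<in> Lambda n k a b" "F x \<noteq> 0" by blast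
      have "F \<in> poly_fun n" using 2(1) assms(2) poly_fun_boundary by auto
      with num obtain N where "\<forall>x. coord_prod x \<noteq> 0 \<longrightarrow> num F x = coord_prod x ^ N * F (lift x)"
        by blast
      then have "num F x \<noteq> 0" using x lift_Lambda[OF x(1)] sub[OF x(1)] boundary_imp_coord_prod by simp
      then show ?thesis using sub[OF x(1)] 2(2) by blast
    qed
  qed (rule conormal_points_line)
  then obtain x where x: "x \<in> conormal_points" "coord_prod x \<noteq> 0"
    "\<And>F. F \<in> insert boundary \<F> \<Longrightarrow> num F x \<noteq> 0" by auto
  have nz: "F (lift x) \<noteq> 0" if F: "F \<in> insert boundary \<F>" for F
  proof -
    have "F \<in> poly_fun n" using F assms(2) poly_fun_boundary by auto
    with num obtain N where "\<forall>x. coord_prod x \<noteq> 0 \<longrightarrow> num F x = coord_prod x ^ N * F (lift x)"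
      by blast
    with x(2) x(3)[OF F] show ?thesis by auto
  qed
  with lift_in_Lambda[OF x(1)] show ?thesis by blast
qed

lemma irreducible_Lambda: "zariski_irreducible_in n X (Lambda n k a b)"
  unfolding zariski_irreducible_in_def
proof (intro conjI allI impI)
  show "Lambda n k a b \<noteq> {}" by (rule Lambda_nonempty)
  fix A B assume "zariski_closed_in n X A" "zariski_closed_in n X B" and sub: "Lambda n k a b \<subseteq> A \<union> B"
  then obtain S T where S: "S \<subseteq> poly_fun n" "A = {x \<in> X. \<forall>F\<in>S. F x = 0}"
    and T: "T \<subseteq> poly_fun n" "B = {x \<in> X. \<forall>F\<in>T. F x = 0}" by (auto simp: zariski_closed_in_def)
  show "Lambda n k a b \<subseteq> A \<or> Lambda n k a b \<subseteq> B"
  proof (rule ccontr)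
    assume "\<not> ?thesis"
    then obtain x y where xy: "x \<in> Lambda n k a b" "x \<notin> A" "y \<in> Lambda n k a b" "y \<notin> B" by blast
    then obtain F G where F: "F \<in> S" "F x \<noteq> 0" and G: "G \<in> T" "G y \<noteq> 0"
      using S(2) T(2) Lambda_subset by blast
    have "\<exists>w\<in>Lambda n k a b. \<forall>H\<in>{F, G}. H w \<noteq> 0"
      by (rule Lambda_common_nonzero) (use F G S(1) T(1) xy in auto)
    then obtain w where w: "w \<in> Lambda n k a b" "F w \<noteq> 0" "G w \<noteq> 0" by auto
    with sub S(2) T(2) F(1) G(1) show False by blast
  qed
qed

section \<open>The defining functions of the graph\<close>

lemma regular_shift:
  assumes "j < n"
  shows "regular_on n X (\<lambda>x. shift x j)"
proof -
  have "regular_on n X (\<lambda>x. 1 / snd x $ j)"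
    using assms by (intro regular_on_inverse_poly poly_fun_snd) (auto simp: ambient_def)
  from regular_on_diff[OF regular_on_poly[OF poly_fun_fst[OF assms]]
      regular_on_mult[OF regular_on_const[of n X "a j"] this]]
  show ?thesis by (simp add: shift_def)
qed

lemma regular_proj_shift: "regular_on n X (\<lambda>x. proj (shift x) j)"
  unfolding proj_def using k_less
  by (intro regular_on_sum regular_on_mult regular_on_const regular_shift) auto

lemma poly_fun_dual: "(\<lambda>x. dual (\<lambda>j. snd x $ j) i) \<in> poly_fun n"
  unfolding dual_def by (intro poly_fun_sum poly_fun_cmult poly_fun_snd) auto

lemma dual_eq_F_linear:
  "dual (\<lambda>j. snd x $ j) i =
    1 / minor b (i # omit_nth i [0..<k]) * F_linear n b (omit_nth i [0..<k]) x"
  by (simp add: dual_def E_def F_linear_def case_prod_unfold sum_divide_distrib)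

lemma Lambda_iff:
  "x \<in> Lambda n k a b \<longleftrightarrow> x \<in> X \<and> (\<forall>i<k. dual (\<lambda>j. snd x $ j) i = 0) \<and>
     (\<forall>j<n. shift x j - proj (shift x) j = 0)"
  by (simp add: Lambda_eq annihilates_iff_dual in_image_iff_proj)

lemma generators_vanish:
  assumes "x \<in> Lambda n k a b"
  shows "is \<in> index_lists n (k - 1) \<Longrightarrow> F_linear n b is x = 0"
    and "is \<in> index_lists n (k + 1) \<Longrightarrow> F_circuit a b is x = 0"
proof -
  have x: "annihilates (\<lambda>j. snd x $ j)" "in_image (shift x)" "\<And>j. j < n \<Longrightarrow> snd x $ j \<noteq> 0"
    using assms by (auto simp: Lambda_eq ambient_def)
  show "F_linear n b is x = 0" if "is \<in> index_lists n (k - 1)"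
  proof -
    have len: "Suc (length is) = k" using index_listsD(1)[OF that] k_pos by simp
    obtain c where "\<forall>j. minor b (j # is) = (\<Sum>l<Suc (length is). b j l * c l)"
      using minor_Cons_linear[of b "is"] ..
    then have c: "minor b (j # is) = (\<Sum>l<k. b j l * c l)" for j unfolding len by blast
    have "F_linear n b is x = (\<Sum>j<n. \<Sum>l<k. b j l * snd x $ j * c l)"
      by (simp add: F_linear_def case_prod_unfold c sum_distrib_left sum_distrib_right mult_ac)
    also have "\<dots> = (\<Sum>l<k. (\<Sum>j<n. b j l * snd x $ j) * c l)"
      by (subst sum.swap) (simp add: sum_distrib_right)
    also have "\<dots> = 0" using x(1) by (simp add: annihilates_def)
    finally show ?thesis .
  qed
  show "F_circuit a b is x = 0" if "is \<in> index_lists n (k + 1)"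
  proof -
    note index = index_listsD[OF that]
    have "circuit_form b is (shift x) = 0"
      by (rule circuit_form_image[OF x(2)]) (use index in simp_all)
    then show ?thesis
      using F_circuit_eq[of "is" x, OF x(3)[OF subsetD[OF index(2), simplified]]] by simp
  qed
qed

text \<open>The transpose of \<open>1 - proj\<close> projects the covectors onto the annihilator of the image.\<close>

definition project_momentum :: "phase_point \<Rightarrow> phase_point" where
  "project_momentum x =
     (fst x, vec n (\<lambda>i. if i < k then snd x $ i - dual (\<lambda>j. snd x $ j) i else snd x $ i))"

lemma project_momentum_conormal:
  assumes "x \<in> phase_space n"
  shows "project_momentum x \<in> conormal_points"
proof -
  have "dual (\<lambda>j. snd (project_momentum x) $ j) i = 0" if i: "i < k" for i
  proof -
    let ?d = "dual (\<lambda>j. snd x $ j)"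
    have "dual (\<lambda>j. snd (project_momentum x) $ j) i =
        (\<Sum>j<n. E j i * snd x $ j - (if j < k then E j i * ?d j else 0))"
      unfolding dual_def[of "\<lambda>j. snd (project_momentum x) $ j"]
      by (rule sum.cong) (auto simp: project_momentum_def algebra_simps)
    also have "\<dots> = ?d i - (\<Sum>j<n. if j < k then E j i * ?d j else 0)"
      by (simp add: sum_subtractf dual_def[of "\<lambda>j. snd x $ j" i])
    also have "(\<Sum>j<n. if j < k then E j i * ?d j else 0) = (\<Sum>j<k. E j i * ?d j)"
      using k_less by (intro sum.mono_neutral_cong_right) auto
    also have "\<dots> = (\<Sum>j<k. if j = i then ?d j else 0)"
      by (rule sum.cong) (use i in \<open>auto simp: E_delta\<close>)
    also have "\<dots> = ?d i" using i by simp
    finally show ?thesis by simp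
  qed
  then show ?thesis
    using assms
    by (auto simp: conormal_points_def annihilates_iff_dual project_momentum_def phase_space_def)
qed

section \<open>The vanishing ideal\<close>

text \<open>Modulo the generators, \<open>z\<close> may be replaced by its value on the graph and then, the
  denominators having been cleared, \<open>p\<close> by its projection onto the annihilator.
  What remains vanishes identically, by density.\<close>

lemma poly_vanishing_on_Lambda_in_ideal:
  assumes J: "fun_ideal {\<phi>. regular_on n X \<phi>} J"
    and J_cong: "\<And>\<phi> \<psi>. \<phi> \<in> J \<Longrightarrow> (\<And>x. x \<in> X \<Longrightarrow> \<phi> x = \<psi> x) \<Longrightarrow> \<psi> \<in> J"
    and linear: "\<And>is. is \<in> index_lists n (k - 1) \<Longrightarrow> F_linear n b is \<in> J"
    and circuit: "\<And>is. is \<in> index_lists n (k + 1) \<Longrightarrow> F_circuit a b is \<in> J"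
    and F: "F \<in> poly_fun n" "\<And>x. x \<in> Lambda n k a b \<Longrightarrow> F x = 0"
  shows "F \<in> J"
proof -
  have mult_J: "(\<lambda>x. f x * g x) \<in> J" if "regular_on n X f" "g \<in> J" for f g
    using fun_ideal_mult[OF J] that by blast
  have zero_J: "\<psi> \<in> J" if "\<And>x. x \<in> X \<Longrightarrow> \<psi> x = 0" for \<psi>
    by (rule J_cong[OF fun_ideal_zero[OF J]]) (simp add: that)
  have dual_J: "(\<lambda>x. dual (\<lambda>j. snd x $ j) i) \<in> J" if "i < k" for i
    unfolding dual_eq_F_linear
    by (rule mult_J[OF regular_on_const linear[OF base_in_index_lists[OF that]]])
  have shift_J: "(\<lambda>x. shift x j - proj (shift x) j) \<in> J" if "j < n" for j
  proof (cases "j < k")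
    case True
    then show ?thesis by (intro zero_J) (simp add: proj_below)
  next
    case False
    let ?is = "[0..<k] @ [j]"
    have mem: "?is \<in> index_lists n (k + 1)" using False that by (intro base_circuit_in_index_lists) auto
    define H where "H x = (\<Prod>l<length ?is. snd x $ (?is ! l)) * ((-1) ^ k * minor b [0..<k])"
      for x :: phase_point
    have idx: "?is ! l < n" if "l < length ?is" for l
      using nth_index_less[OF index_listsD(2)[OF mem] that] .
    have H_poly: "H \<in> poly_fun n"
      unfolding H_def by (intro poly_fun.mult poly_fun_prod poly_fun_snd poly_fun.const) (use idx in auto)
    have "minor b [0..<k] \<noteq> 0" using k_less by (intro minor_nonzero) auto
    then have H_nz: "H x \<noteq> 0" if "x \<in> X" for x
      using that idx by (auto simp: H_def ambient_def simp del: nth_append)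
    have "(\<lambda>x. 1 / H x * F_circuit a b ?is x) \<in> J"
      by (rule mult_J[OF regular_on_inverse_poly[OF H_poly H_nz] circuit[OF mem]])
    then show ?thesis
    proof (rule J_cong)
      fix x assume x: "x \<in> X"
      have "F_circuit a b ?is x = H x * (shift x j - proj (shift x) j)"
        unfolding H_def
        by (subst F_circuit_eq)
          (use x index_listsD(2)[OF mem] False that in \<open>auto simp: ambient_def circuit_form_base\<close>)
      with H_nz[OF x] show "1 / H x * F_circuit a b ?is x = shift x j - proj (shift x) j" by simp
    qed
  qed
  obtain P N where P: "P \<in> poly_fun n"
    "\<And>x. coord_prod x \<noteq> 0 \<Longrightarrow> P x = coord_prod x ^ N * F (lift x)"
    using poly_fun_lift_numerator[OF F(1)] by blast
  \<comment> \<open>Where \<open>lift\<close> is defined and lands in the ambient space, it lands in the variety; such points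
    are dense in the affine space.\<close>
  have P_zero: "P x = 0" if x: "x \<in> conormal_points" for x
  proof (rule ccontr)
    assume "P x \<noteq> 0"
    obtain Q M where Q: "Q \<in> poly_fun n"
      "\<And>x. coord_prod x \<noteq> 0 \<Longrightarrow> Q x = coord_prod x ^ M * boundary (lift x)"
      using poly_fun_lift_numerator[OF poly_fun_boundary] by blast
    obtain y where "y \<in> Lambda n k a b" using Lambda_nonempty by blast
    then have y: "y \<in> conormal_points" "coord_prod y \<noteq> 0" "Q y \<noteq> 0"
      using lift_Lambda[of y] Q(2)[of y] boundary_imp_coord_prod[of y]
      by (auto simp: Lambda_eq conormal_points_def ambient_eq)
    have "\<exists>x\<in>conormal_points. \<forall>F\<in>{P, Q, coord_prod}. F x \<noteq> 0"
    proof (rule common_nonzero_point)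
      show "{P, Q, coord_prod} \<subseteq> poly_fun n" using P(1) Q(1) poly_fun_coord_prod by simp
      show "conormal_points \<subseteq> phase_space n" by (auto simp: conormal_points_def)
      show "conormal_points \<noteq> {}" using x by blast
      show "\<exists>x\<in>conormal_points. F x \<noteq> 0" if "F \<in> {P, Q, coord_prod}" for F
        using that x y \<open>P x \<noteq> 0\<close> by blast
    qed (simp_all add: conormal_points_line)
    then obtain w where w: "w \<in> conormal_points" "P w \<noteq> 0" "Q w \<noteq> 0" "coord_prod w \<noteq> 0" by auto
    then have "boundary (lift w) \<noteq> 0" using Q(2) by auto
    then have "F (lift w) = 0" using lift_in_Lambda[OF w(1)] F(2) by blast
    with P(2)[OF w(4)] w(2) show False by simp
  qed
  have lift_regular: "regular_on n X (\<lambda>x. fst (lift x) $ j)"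
    and lift_diff: "(\<lambda>x. fst x $ j - fst (lift x) $ j) \<in> J" if j: "j < n" for j
  proof -
    have "fst (lift x) $ j = fst x $ j - (shift x j - proj (shift x) j)" for x
      using j by (simp add: lift_def shift_def)
    then show "regular_on n X (\<lambda>x. fst (lift x) $ j)" "(\<lambda>x. fst x $ j - fst (lift x) $ j) \<in> J"
      using shift_J[OF j]
      by (simp_all add: regular_on_diff regular_on_poly poly_fun_fst j regular_shift regular_proj_shift)
  qed
  have step1: "(\<lambda>x. F x - F (lift x)) \<in> J"
    using poly_fun_congruent_substitution[OF J lift_regular _ lift_diff _ F(1)]
    by (simp add: lift_def regular_on_poly poly_fun_snd fun_ideal_zero[OF J])
  have pm_regular: "regular_on n X (\<lambda>x. snd (project_momentum x) $ i)"
    and pm_diff: "(\<lambda>x. snd x $ i - snd (project_momentum x) $ i) \<in> J" if i: "i < n" for i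
    using i dual_J[of i] fun_ideal_zero[OF J]
    by (cases "i < k"; simp add: project_momentum_def regular_on_poly poly_fun_diff poly_fun_snd
        poly_fun_dual)+
  have "(\<lambda>x. P x - P (project_momentum x)) \<in> J"
    using poly_fun_congruent_substitution[OF J _ pm_regular _ pm_diff P(1)]
    by (simp add: project_momentum_def regular_on_poly poly_fun_fst fun_ideal_zero[OF J])
  then have P_J: "P \<in> J"
  proof (rule J_cong)
    fix x assume "x \<in> X"
    then have "x \<in> phase_space n" by (simp add: ambient_eq)
    then show "P x - P (project_momentum x) = P x"
      using P_zero[OF project_momentum_conormal] by simp
  qed
  have c_nz: "coord_prod x ^ N \<noteq> 0" if "x \<in> X" for x
    using that boundary_imp_coord_prod by (auto simp: ambient_eq)
  have "(\<lambda>x. 1 / coord_prod x ^ N * P x) \<in> J"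
    by (rule mult_J[OF regular_on_inverse_poly P_J])
      (use c_nz in \<open>auto intro: poly_fun_power poly_fun_coord_prod\<close>)
  then have step2: "(\<lambda>x. F (lift x)) \<in> J"
  proof (rule J_cong)
    fix x assume "x \<in> X"
    from c_nz[OF this] P(2)[of x] show "1 / coord_prod x ^ N * P x = F (lift x)"
      using boundary_imp_coord_prod[of x] \<open>x \<in> X\<close> by (simp add: ambient_eq)
  qed
  from fun_ideal_add[OF J step1 step2] show ?thesis by simp
qed

lemma genideal_eq_vanishing_ideal:
  "genideal (regular_ring n X) (generators n k a b) = vanishing_ideal n X (Lambda n k a b)"
proof (rule equalityI)
  have gen: "generators n k a b \<subseteq> vanishing_ideal n X (Lambda n k a b)"
  proof
    fix \<phi> assume "\<phi> \<in> generators n k a b"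
    then obtain F where F: "\<phi> = restrict F X" "F \<in> poly_fun n" "\<And>x. x \<in> Lambda n k a b \<Longrightarrow> F x = 0"
      unfolding generators_def
      using poly_fun_F_linear poly_fun_F_circuit[OF index_listsD(2)] generators_vanish by blast
    then show "\<phi> \<in> vanishing_ideal n X (Lambda n k a b)"
      using Lambda_subset by (auto simp: vanishing_ideal_def regular_ring_simps intro: regular_on_poly)
  qed
  show "genideal (regular_ring n X) (generators n k a b) \<subseteq> vanishing_ideal n X (Lambda n k a b)"
    unfolding genideal_def using ideal_vanishing_ideal[OF Lambda_subset] gen by blast
next
  show "vanishing_ideal n X (Lambda n k a b) \<subseteq> genideal (regular_ring n X) (generators n k a b)"
    unfolding genideal_def
  proof (intro subsetI InterI, clarify)
    fix \<phi> I assume \<phi>: "\<phi> \<in> vanishing_ideal n X (Lambda n k a b)"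
      and I: "ideal I (regular_ring n X)" "generators n k a b \<subseteq> I"
    define J where "J = {\<psi>. regular_on n X \<psi> \<and> restrict \<psi> X \<in> I}"
    have J: "fun_ideal {\<phi>. regular_on n X \<phi>} J"
      unfolding J_def by (rule fun_ideal_of_ring_ideal[OF I(1)])
    have J_cong: "\<psi>' \<in> J" if "\<psi> \<in> J" "\<And>x. x \<in> X \<Longrightarrow> \<psi> x = \<psi>' x" for \<psi> \<psi>'
    proof -
      have "restrict \<psi> X = restrict \<psi>' X" using that(2) by (rule restrict_ext)
      then show ?thesis using that regular_on_cong[where n = n, OF that(2)] by (simp add: J_def)
    qed
    have lin: "F_linear n b is \<in> J" if "is \<in> index_lists n (k - 1)" for "is"
      using that I(2) by (auto simp: J_def generators_def regular_on_poly poly_fun_F_linear)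
    have cir: "F_circuit a b is \<in> J" if "is \<in> index_lists n (k + 1)" for "is"
      using that I(2) index_listsD(2)[OF that]
      by (auto simp: J_def generators_def regular_on_poly poly_fun_F_circuit)
    have reg: "regular_on n X \<phi>" and ext: "\<phi> \<in> extensional X"
      and van: "\<And>x. x \<in> Lambda n k a b \<Longrightarrow> \<phi> x = 0"
      using \<phi> by (auto simp: vanishing_ideal_def regular_ring_simps)
    have "\<phi> \<in> J"
    proof (rule locally_in_ideal_imp_in_ideal[OF poly_fun_boundary ambient_eq J J_cong])
      fix x assume "x \<in> X"
      from regular_onE[OF reg this] obtain G H where GH: "G \<in> poly_fun n" "H \<in> poly_fun n"
        "H x \<noteq> 0" "\<And>y. y \<in> X \<Longrightarrow> H y * \<phi> y = G y" by metis
      have "G y = 0" if "y \<in> Lambda n k a b" for y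
        using GH(4)[of y] van[OF that] that Lambda_subset by auto
      from poly_vanishing_on_Lambda_in_ideal[OF J J_cong lin cir GH(1) this]
      have "G \<in> J" .
      then have "(\<lambda>y. H y * \<phi> y) \<in> J" by (rule J_cong) (simp add: GH(4))
      with GH(2,3) show "\<exists>H\<in>poly_fun n. H x \<noteq> 0 \<and> (\<lambda>y. H y * \<phi> y) \<in> J" by blast
    qed
    then show "\<phi> \<in> I" using ext by (simp add: J_def extensional_restrict)
  qed
qed

section \<open>Smoothness and tangent spaces\<close>

text \<open>The differential of \<open>z\<^sub>j - a\<^sub>j / p\<^sub>j\<close> at \<open>x\<close>.\<close>

definition shift_differential :: "phase_point \<Rightarrow> phase_point \<Rightarrow> nat \<Rightarrow> complex" where
  "shift_differential x v j = fst v $ j + a j * snd v $ j / (snd x $ j)\<^sup>2"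

lemma shift_derivative:
  assumes "curve_at n \<gamma> x v" "j < n" "snd x $ j \<noteq> 0"
  shows "((\<lambda>s. shift (\<gamma> s) j) has_field_derivative shift_differential x v j) (at 0)"
proof -
  have [simp]: "\<gamma> 0 = x"
    and d: "((\<lambda>s. fst (\<gamma> s) $ j) has_field_derivative fst v $ j) (at 0)"
      "((\<lambda>s. snd (\<gamma> s) $ j) has_field_derivative snd v $ j) (at 0)"
    using assms by (auto simp: curve_at_def)
  have "((\<lambda>s. a j / snd (\<gamma> s) $ j) has_field_derivative - (a j * snd v $ j / (snd x $ j)\<^sup>2)) (at 0)"
    using DERIV_divide[OF DERIV_const[of "a j"] d(2)] assms(3) by (simp add: power2_eq_square)
  from DERIV_diff[OF d(1) this] show ?thesis by (simp add: shift_def shift_differential_def)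
qed

lemma proj_derivative:
  assumes "\<And>j. j < n \<Longrightarrow> ((\<lambda>s. y s j) has_field_derivative y' j) (at 0)"
  shows "((\<lambda>s. proj (y s) j) has_field_derivative proj y' j) (at 0)"
  unfolding proj_def using assms k_less by (intro DERIV_sum DERIV_cmult) auto

lemma dual_derivative:
  assumes "\<And>j. j < n \<Longrightarrow> ((\<lambda>s. y s j) has_field_derivative y' j) (at 0)"
  shows "((\<lambda>s. dual (y s) i) has_field_derivative dual y' i) (at 0)"
  unfolding dual_def using assms by (intro DERIV_sum DERIV_cmult) auto

lemma ambient_phase_space: "x \<in> X \<Longrightarrow> x \<in> phase_space n"
  by (simp add: ambient_eq)

lemma ambient_snd_nonzero: "x \<in> X \<Longrightarrow> j < n \<Longrightarrow> snd x $ j \<noteq> 0"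
  by (auto simp: ambient_def)

lemma differential_dual:
  assumes "x \<in> X" "v \<in> phase_space n"
  shows "differential (\<lambda>x. dual (\<lambda>j. snd x $ j) i) x v = dual (\<lambda>j. snd v $ j) i"
  unfolding differential_def
  using curve_at_straight[OF ambient_phase_space[OF assms(1)] assms(2)]
  by (intro DERIV_imp_deriv dual_derivative) (simp add: curve_at_def)

lemma differential_shift:
  assumes "x \<in> X" "v \<in> phase_space n" "j < n"
  shows "differential (\<lambda>x. shift x j - proj (shift x) j) x v =
    shift_differential x v j - proj (shift_differential x v) j"
  unfolding differential_def
  using curve_at_straight[OF ambient_phase_space[OF assms(1)] assms(2)] ambient_snd_nonzero[OF assms(1)]
    assms(3)
  by (intro DERIV_imp_deriv DERIV_diff proj_derivative shift_derivative) auto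

text \<open>The first \<open>k\<close> functions cut out the annihilator in the \<open>p\<close>-space, the others the
  translate of the image in the \<open>z\<close>-space.\<close>

definition defining_function :: "nat \<Rightarrow> phase_point \<Rightarrow> complex" where
  "defining_function i = (if i < k then (\<lambda>x. dual (\<lambda>j. snd x $ j) i)
     else (\<lambda>x. shift x i - proj (shift x) i))"

lemma smooth_Lambda: "smooth_of_codim n X (Lambda n k a b) n"
  unfolding smooth_of_codim_def
proof (intro ballI exI conjI allI impI)
  fix x assume "x \<in> Lambda n k a b"
  then show x: "x \<in> X" using Lambda_subset by blast
  show "zariski_open_in n X X" by (rule zariski_open_in_self)
  show "regular_on n X (defining_function i)" if "i < n" for i
    using that by (simp add: defining_function_def regular_on_poly poly_fun_dual regular_on_diff
        regular_shift regular_proj_shift)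
  show "Lambda n k a b \<inter> X = {y \<in> X. \<forall>i<n. defining_function i y = 0}"
  proof -
    have "(\<forall>i<n. defining_function i y = 0) \<longleftrightarrow> (\<forall>i<k. dual (\<lambda>j. snd y $ j) i = 0) \<and>
      (\<forall>j<n. shift y j - proj (shift y) j = 0)" (is "?L \<longleftrightarrow> ?R") for y
    proof
      assume L: ?L
      have "shift y j - proj (shift y) j = 0" if "j < n" for j
        using L[rule_format, OF that] by (cases "j < k") (simp_all add: defining_function_def proj_below)
      moreover have "dual (\<lambda>j. snd y $ j) i = 0" if "i < k" for i
        using L[rule_format, of i] that k_less by (simp add: defining_function_def)
      ultimately show ?R by blast
    next
      assume ?R
      then show ?L by (simp add: defining_function_def)
    qed
    then show ?thesis using Lambda_subset by (auto simp only: Lambda_iff)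
  qed
  fix c :: "nat \<Rightarrow> complex" and i
  assume c: "\<forall>v\<in>phase_space n. (\<Sum>i<n. c i * differential (defining_function i) x v) = 0" and "i < n"
  have low: "differential (defining_function i) x v = dual (\<lambda>j. snd v $ j) i"
    if "i < k" "v \<in> phase_space n" for i v
    using that differential_dual[OF x] by (simp add: defining_function_def)
  have high: "differential (defining_function i) x v =
      shift_differential x v i - proj (shift_differential x v) i"
    if "k \<le> i" "i < n" "v \<in> phase_space n" for i v
    using that differential_shift[OF x] by (simp add: defining_function_def)
  \<comment> \<open>The vectors \<open>(e\<^sub>i, 0)\<close>, \<open>k \<le> i\<close>, are dual to the second group and killed by the first.\<close>
  have c_high: "c i = 0" if i: "k \<le> i" "i < n" for i
  proof -
    let ?v = "(unit_vec n i, 0\<^sub>v n) :: phase_point"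
    have v: "?v \<in> phase_space n" by (simp add: phase_space_def)
    have sd: "shift_differential x ?v j = (if j = i then 1 else 0)" if "j < n" for j
      using that i by (simp add: shift_differential_def unit_vec_def)
    have "proj (shift_differential x ?v) j = 0" for j
      unfolding proj_def using i k_less by (intro sum.neutral) (auto simp: sd)
    then have "c j * differential (defining_function j) x ?v = (if j = i then c j else 0)" if "j < n" for j
      using that i low[OF _ v] high[OF _ _ v] by (cases "j < k") (auto simp: sd dual_def)
    then have "(\<Sum>j<n. c j * differential (defining_function j) x ?v) = c i" using i by simp
    with c v show ?thesis by simp
  qed
  show "c i = 0"
  proof (cases "i < k")
    case True
    let ?v = "(0\<^sub>v n, unit_vec n i) :: phase_point"
    have v: "?v \<in> phase_space n" by (simp add: phase_space_def)
    have "c j * differential (defining_function j) x ?v = (if j = i then c j else 0)" if "j < n" for j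
    proof (cases "j < k")
      case jk: True
      have "dual (\<lambda>j. snd ?v $ j) j = (\<Sum>l<n. if l = i then E l j else 0)"
        unfolding dual_def by (rule sum.cong) (auto simp: unit_vec_def)
      then show ?thesis using low[OF jk v] True jk \<open>i < n\<close> by (simp add: E_delta)
    next
      case False
      then show ?thesis using c_high that True by auto
    qed
    then have "(\<Sum>j<n. c j * differential (defining_function j) x ?v) = c i" using \<open>i < n\<close> by simp
    with c v show ?thesis by simp
  qed (use c_high \<open>i < n\<close> in auto)
qed

lemma eventually_in_ambient:
  assumes "curve_at n \<gamma> x v" "x \<in> X"
  shows "eventually (\<lambda>s. \<gamma> s \<in> X) (nhds 0)"
proof -
  have "eventually (\<lambda>s. boundary (\<gamma> s) \<noteq> 0) (nhds 0)"
    by (rule poly_fun_eventually_nonzero[OF poly_fun_boundary assms(1)])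
      (use assms(2) in \<open>simp add: ambient_eq\<close>)
  moreover have "\<gamma> s \<in> phase_space n" for s using assms(1) by (auto simp: curve_at_def)
  ultimately show ?thesis by (simp add: ambient_eq)
qed

lemma differential_restrict:
  assumes "x \<in> X" "v \<in> phase_space n"
  shows "differential (restrict \<phi> X) x v = differential \<phi> x v"
  unfolding differential_def
  using eventually_in_ambient[OF curve_at_straight[OF ambient_phase_space[OF assms(1)] assms(2)] assms(1)]
  by (intro deriv_cong_ev refl) (auto elim: eventually_mono)

text \<open>Tangent vectors satisfying the linearised equations are velocities of curves in the
  variety: the images of straight lines under the graph map.\<close>

lemma tangent_space_Lambda:
  assumes "x \<in> Lambda n k a b"
  shows "zariski_tangent_space n X (Lambda n k a b) x =
    {v \<in> phase_space n. annihilates (\<lambda>j. snd v $ j) \<and> in_image (shift_differential x v)}"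
proof (intro equalityI subsetI)
  have x: "x \<in> X" using assms Lambda_subset by blast
  fix v assume v: "v \<in> zariski_tangent_space n X (Lambda n k a b) x"
  then have vp: "v \<in> phase_space n" by (simp add: zariski_tangent_space_def)
  have zero: "differential \<phi> x v = 0"
    if "regular_on n X \<phi>" "\<And>y. y \<in> Lambda n k a b \<Longrightarrow> \<phi> y = 0" for \<phi>
  proof -
    have "restrict \<phi> X \<in> vanishing_ideal n X (Lambda n k a b)"
      using that Lambda_subset by (auto simp: vanishing_ideal_def regular_ring_simps)
    then have "differential (restrict \<phi> X) x v = 0" using v by (auto simp: zariski_tangent_space_def)
    then show ?thesis by (simp add: differential_restrict[OF x vp])
  qed
  have "dual (\<lambda>j. snd v $ j) i = 0" if "i < k" for i
    using zero[OF regular_on_poly[OF poly_fun_dual], of i] that Lambda_iff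
    by (simp add: differential_dual[OF x vp])
  moreover have "shift_differential x v j = proj (shift_differential x v) j" if "j < n" for j
    using zero[OF regular_on_diff[OF regular_shift[OF that] regular_proj_shift], of j] that Lambda_iff
    by (simp add: differential_shift[OF x vp])
  ultimately show "v \<in> {v \<in> phase_space n. annihilates (\<lambda>j. snd v $ j) \<and>
      in_image (shift_differential x v)}"
    using vp by (simp add: annihilates_iff_dual in_image_iff_proj)
next
  have x: "x \<in> X" using assms Lambda_subset by blast
  fix v assume "v \<in> {v \<in> phase_space n. annihilates (\<lambda>j. snd v $ j) \<and>
      in_image (shift_differential x v)}"
  then have v: "v \<in> phase_space n" "annihilates (\<lambda>j. snd v $ j)"
    "\<And>j. j < n \<Longrightarrow> proj (shift_differential x v) j = shift_differential x v j"
    by (simp_all add: in_image_iff_proj)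
  define y where "y s = (fst x + s \<cdot>\<^sub>v fst v, snd x + s \<cdot>\<^sub>v snd v)" for s
  have y: "curve_at n y x v"
    unfolding y_def by (rule curve_at_straight[OF ambient_phase_space[OF x] v(1)])
  define \<gamma> where "\<gamma> s = lift (y s)" for s
  have y_phase: "y s \<in> phase_space n" for s using y by (auto simp: curve_at_def)
  have y_conormal: "y s \<in> conormal_points" for s
  proof -
    have "(\<Sum>j<n. b j m * snd (y s) $ j) = 0" if "m < k" for m
    proof -
      have "(\<Sum>j<n. b j m * snd (y s) $ j) =
        (\<Sum>j<n. b j m * snd x $ j) + s * (\<Sum>j<n. b j m * snd v $ j)"
        unfolding sum_distrib_left sum.distrib[symmetric]
        by (rule sum.cong)
          (use x v(1) in \<open>auto simp: y_def phase_space_def ambient_def algebra_simps\<close>)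
      then show ?thesis using that v(2) assms by (simp add: annihilates_def Lambda_eq)
    qed
    then show ?thesis using y_phase by (simp add: conormal_points_def annihilates_def)
  qed
  have \<gamma>: "curve_at n \<gamma> x v"
    unfolding curve_at_def
  proof (intro conjI allI impI)
    show "range \<gamma> \<subseteq> phase_space n"
      using y_phase by (auto simp: \<gamma>_def lift_def phase_space_def mem_Times_iff)
    have "y 0 = x" using y by (simp add: curve_at_def)
    then show "\<gamma> 0 = x" by (simp add: \<gamma>_def lift_Lambda[OF assms])
    fix j assume j: "j < n"
    show "((\<lambda>s. snd (\<gamma> s) $ j) has_field_derivative snd v $ j) (at 0)"
      using y j by (simp add: \<gamma>_def lift_def curve_at_def)
    have d: "((\<lambda>s. fst (y s) $ j) has_field_derivative fst v $ j) (at 0)"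
      using y j by (simp add: curve_at_def)
    have s: "((\<lambda>s. shift (y s) i) has_field_derivative shift_differential x v i) (at 0)" if "i < n" for i
      by (rule shift_derivative[OF y that ambient_snd_nonzero[OF x that]])
    from DERIV_add[OF DERIV_diff[OF d s[OF j]] proj_derivative[where y = "\<lambda>s. shift (y s)", OF s, of j]]
    show "((\<lambda>s. fst (\<gamma> s) $ j) has_field_derivative fst v $ j) (at 0)"
      using j v(3)[OF j] by (simp add: \<gamma>_def lift_def shift_def)
  qed
  have on_Lambda: "eventually (\<lambda>s. \<gamma> s \<in> Lambda n k a b) (nhds 0)"
    using eventually_in_ambient[OF \<gamma> x]
    by eventually_elim
      (use y_conormal in \<open>auto simp: \<gamma>_def ambient_eq intro: lift_in_Lambda\<close>)
  have "differential \<phi> x v = 0" if \<phi>: "\<phi> \<in> vanishing_ideal n X (Lambda n k a b)" for \<phi>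
  proof -
    have "regular_on n X \<phi>" using \<phi> by (simp add: vanishing_ideal_def regular_ring_simps)
    from regular_on_chain_rule[OF poly_fun_boundary ambient_eq this x v(1) \<gamma>]
    have "((\<lambda>s. \<phi> (\<gamma> s)) has_field_derivative differential \<phi> x v) (at 0)" .
    moreover have "eventually (\<lambda>s. \<phi> (\<gamma> s) = 0) (nhds 0)"
      using on_Lambda by eventually_elim (use \<phi> in \<open>auto simp: vanishing_ideal_def\<close>)
    ultimately have "((\<lambda>s. 0) has_field_derivative differential \<phi> x v) (at 0)"
      by (subst (asm) DERIV_cong_ev[OF refl _ refl])
    then show ?thesis using DERIV_const DERIV_unique by blast
  qed
  with v(1) show "v \<in> zariski_tangent_space n X (Lambda n k a b) x"
    by (simp add: zariski_tangent_space_def)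
qed

text \<open>The covectors \<open>e\<^sub>j - \<Sum>\<^sub>i E j i e\<^sub>i\<close>, \<open>j \<ge> k\<close>, annihilate the image and express membership in it.\<close>

lemma in_image_if_orthogonal:
  assumes "\<And>p. annihilates p \<Longrightarrow> (\<Sum>j<n. p j * y j) = 0"
  shows "in_image y"
  unfolding in_image_iff_proj
proof (intro allI impI)
  fix j assume j: "j < n"
  show "y j = proj y j"
  proof (cases "j < k")
    case True
    then show ?thesis by (simp add: proj_below)
  next
    case False
    define p where "p i = (if i < k then - E j i else if i = j then 1 else 0)" for i
    have expand: "(\<Sum>i<n. p i * y i) = y j - proj y j" for y
    proof -
      have "(\<Sum>i<n. p i * y i) = (\<Sum>i<n. (if i = j then y i else 0) - (if i < k then E j i * y i else 0))"
        by (rule sum.cong) (use False in \<open>auto simp: p_def\<close>)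
      also have "\<dots> = y j - (\<Sum>i<n. if i < k then E j i * y i else 0)"
        using j by (simp add: sum_subtractf)
      also have "(\<Sum>i<n. if i < k then E j i * y i else 0) = proj y j"
        unfolding proj_def using k_less by (intro sum.mono_neutral_cong_right) auto
      finally show ?thesis .
    qed
    have "annihilates p"
      unfolding annihilates_def
    proof (intro allI impI)
      fix m assume m: "m < k"
      have "in_image (\<lambda>i. b i m)"
        unfolding in_image_def
        by (rule exI[of _ "\<lambda>l. if l = m then 1 else 0"])
          (use m in \<open>auto simp: if_distrib[of "\<lambda>c. _ * c"] cong: if_cong\<close>)
      then have "b j m - proj (\<lambda>i. b i m) j = 0" using j by (simp add: in_image_iff_proj)
      then show "(\<Sum>i<n. b i m * p i) = 0" using expand[of "\<lambda>i. b i m"] by (simp add: mult.commute)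
    qed
    with assms[of p] expand[of y] show ?thesis by simp
  qed
qed

text \<open>In the coordinates \<open>(y, \<pi>)\<close>, where \<open>y = \<zeta> + a \<pi> / p\<^sup>2\<close>, the form is still
  \<open>\<Sum> d\<pi> \<and> dy\<close>, and the tangent space is the product \<open>V \<times> W\<close> of the image and its annihilator.\<close>

lemma lagrangian_tangent_space:
  assumes "x \<in> Lambda n k a b"
  shows "lagrangian_subspace n (zariski_tangent_space n X (Lambda n k a b) x)"
proof -
  have form: "symplectic_form n v w =
      (\<Sum>j<n. snd v $ j * shift_differential x w j) - (\<Sum>j<n. snd w $ j * shift_differential x v j)"
    for v w
    by (simp add: symplectic_form_def shift_differential_def sum_subtractf[symmetric] algebra_simps)
  let ?T = "{v \<in> phase_space n. annihilates (\<lambda>j. snd v $ j) \<and> in_image (shift_differential x v)}"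
  have "v \<in> ?T" if v: "v \<in> phase_space n" "\<forall>w\<in>?T. symplectic_form n v w = 0" for v
  proof -
    have "annihilates (\<lambda>j. snd v $ j)"
      unfolding annihilates_def
    proof (intro allI impI)
      fix m assume m: "m < k"
      \<comment> \<open>\<open>V \<times> {0}\<close> lies in the tangent space and forces \<open>\<pi>\<close> into \<open>W\<close>; below, \<open>0 \<times> W\<close> forces \<open>y\<close> into \<open>V\<close>.\<close>
      let ?w = "(vec n (\<lambda>j. b j m), 0\<^sub>v n) :: phase_point"
      have sd: "shift_differential x ?w j = b j m" if "j < n" for j
        using that by (simp add: shift_differential_def)
      have "in_image (shift_differential x ?w)"
        unfolding in_image_def
        by (rule exI[of _ "\<lambda>l. if l = m then 1 else 0"])
          (use m in \<open>auto simp: sd if_distrib[of "\<lambda>c. _ * c"] cong: if_cong\<close>)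
      then have "?w \<in> ?T" by (simp add: phase_space_def annihilates_def)
      then have "symplectic_form n v ?w = 0" using v(2) by blast
      then show "(\<Sum>j<n. b j m * snd v $ j) = 0" by (simp add: form sd mult.commute)
    qed
    moreover have "in_image (shift_differential x v)"
    proof (rule in_image_if_orthogonal)
      fix p assume p: "annihilates p"
      let ?w = "(vec n (\<lambda>j. - (a j * p j / (snd x $ j)\<^sup>2)), vec n p) :: phase_point"
      have sd: "shift_differential x ?w j = 0" if "j < n" for j
        using that by (simp add: shift_differential_def)
      have "in_image (shift_differential x ?w)"
        unfolding in_image_def by (rule exI[of _ "\<lambda>_. 0"]) (simp add: sd)
      then have "?w \<in> ?T" using p by (simp add: phase_space_def annihilates_def)
      then have "symplectic_form n v ?w = 0" using v(2) by blast
      then show "(\<Sum>j<n. p j * shift_differential x v j) = 0" by (simp add: form sd)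
    qed
    ultimately show ?thesis using v(1) by simp
  qed
  moreover have "symplectic_form n v w = 0" if "v \<in> ?T" "w \<in> ?T" for v w
    using that by (simp add: form pairing_zero)
  ultimately show ?thesis
    unfolding lagrangian_subspace_def tangent_space_Lambda[OF assms] by blast
qed

lemma closed_Lambda: "zariski_closed_in n X (Lambda n k a b)"
  unfolding zariski_closed_in_def
proof (intro exI conjI)
  let ?S = "F_linear n b ` index_lists n (k - 1) \<union> F_circuit a b ` index_lists n (k + 1)"
  show "?S \<subseteq> poly_fun n" using poly_fun_F_linear poly_fun_F_circuit index_listsD(2) by blast
  show "Lambda n k a b = {x \<in> X. \<forall>F\<in>?S. F x = 0}"
  proof (intro equalityI subsetI)
    fix x assume "x \<in> Lambda n k a b"
    then show "x \<in> {x \<in> X. \<forall>F\<in>?S. F x = 0}"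
      using generators_vanish[of x] Lambda_subset by auto
  next
    fix x assume "x \<in> {x \<in> X. \<forall>F\<in>?S. F x = 0}"
    then have x: "x \<in> X" "\<And>is. is \<in> index_lists n (k - 1) \<Longrightarrow> F_linear n b is x = 0"
      "\<And>is. is \<in> index_lists n (k + 1) \<Longrightarrow> F_circuit a b is x = 0" by auto
    have "shift x j - proj (shift x) j = 0" if j: "j < n" for j
    proof (cases "j < k")
      case False
      let ?is = "[0..<k] @ [j]"
      have mem: "?is \<in> index_lists n (k + 1)" using False j by (intro base_circuit_in_index_lists) auto
      have nz: "snd x $ i \<noteq> 0" if "i \<in> set ?is" for i
        using ambient_snd_nonzero[OF x(1)] index_listsD(2)[OF mem] that by blast
      then have "(\<Prod>l<length ?is. snd x $ (?is ! l)) \<noteq> 0"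
        using nth_mem[of _ ?is] by (simp del: nth_append set_append)
      then have "circuit_form b ?is (shift x) = 0"
        using F_circuit_eq[of ?is x, OF nz] x(3)[OF mem] by simp
      moreover have "minor b [0..<k] \<noteq> 0" using k_less by (intro minor_nonzero) auto
      ultimately show ?thesis using False j by (simp add: circuit_form_base)
    qed (simp add: proj_below)
    then show "x \<in> Lambda n k a b"
      using x(1,2) base_in_index_lists by (simp add: Lambda_iff dual_eq_F_linear)
  qed
qed

end

theorem theorem3p3:
  fixes n k :: nat
    and a :: "nat \<Rightarrow> complex"
    and b :: "nat \<Rightarrow> nat \<Rightarrow> complex"
  assumes "0 < k" and "k < n"
    and "\<And>is. length is = k \<Longrightarrow> distinct is \<Longrightarrow> set is \<subseteq> {..<n} \<Longrightarrow> minor b is \<noteq> 0"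
    and "\<And>j. j < n \<Longrightarrow> a j \<noteq> 0"
    and "(\<Sum>j<n. a j) \<noteq> 0"
  shows "genideal (regular_ring n (ambient n k b)) (generators n k a b)
           = vanishing_ideal n (ambient n k b) (Lambda n k a b)
       \<and> smooth_lagrangian_subvariety n (ambient n k b) (Lambda n k a b)"
proof -
  interpret generic_arrangement n k a b
    by unfold_locales (use assms in auto)
  show ?thesis
    unfolding smooth_lagrangian_subvariety_def subvariety_def
    using genideal_eq_vanishing_ideal closed_Lambda irreducible_Lambda smooth_Lambda
      lagrangian_tangent_space by blast
qed

end
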